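(* Let $(X,\ll,\leq,\mathfrak T)$ be a topological causal space and let $(H,G,\mathfrak m)$ be a synthetic null hypersurface in $X$ satisfying the Null Energy Condition $\mathsf{NC}^e(N)$ for some $N>1$. Assume that the gauge $G$ is tight. Then the sets $\mathfrak a(H)$ of initial points and $\mathfrak b(H)$ of final points of $H$ are negligible: $$\mathfrak m(\mathfrak a(H))=\mathfrak m(\mathfrak b(H))=0.$$
   Context: A causal space $(X,\ll,\le)$ is a set $X$ with a preorder $\le$ and a transitive relation $\ll$ contained in $\le$. A topological causal space $(X,\ll,\leq,\mathfrak T)$ is a causal space with a Polish topology $\mathfrak T$ induced by a separable proper metric (closed balls are compact), such that $J:=\{(x,y):x\le y\}$ is closed and $\{(x,y):x\ll y\}$ is open in $X\times X$. A set $H$ is achronal if no $x,y\in H$ satisfy $x\ll y$. A causal curve is a continuous $\gamma:I\to X$ ($I$ an interval) with $\gamma_s\le\gamma_t$ for all $s\le t$ (constant curves allowed). For a closed achronal set $H$: initial points $\mathfrak a(H)=\{m\in H:\nexists x\in H,\ x\le m,\ x\ne m\}$; final points $\mathfrak b(H)=\{m\in H:\nexists x\in H,\ m\le x,\ x\neq m\}$; static points $\mathfrak s(H)=\mathfrak a(H)\cap\mathfrak b(H)$; $H^\circ=H\setminus(\mathfrak a(H)\cup\mathfrak b(H))$. A gauge for $H$ is a Borel map $G:H^\circ\to\mathbb R$ such that (1) for any injective causal curve $\gamma$ in $H^\circ$, $G\circ\gamma$ is strictly increasing and continuous; (2) for any causal $\gamma:[0,1]\to H$ with $\gamma((0,1))\subset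 H^\circ$, $\sup_{(0,1)}G\circ\gamma$ and $\inf_{(0,1)}G\circ\gamma$ are finite. A curve $\gamma:[0,1]\to H$ is $G$-causal if it is constant, or it is causal with $\gamma((0,1))\subset H^\circ$ and $G\circ\gamma|_{(0,1)}$ affine. $\mathrm{Caus}_G\subset C([0,1];H)$ is the set of $G$-causal curves (uniform topology). The gauge $G$ is tight if every $x\in H$ has a compact neighbourhood $U$ such that $\{\gamma\in\mathrm{Caus}_G:\gamma_0,\gamma_1\in U\}$ is compact in $C([0,1];H)$. A synthetic null hypersurface is a triple $(H,G,\mathfrak m)$ with $H$ closed achronal, $G$ a gauge for $H$, and $\mathfrak m$ a non-negative Radon measure on $H$ with $\mathfrak m(\mathfrak s(H))=0$. $\Pi_\le(\mu_0,\mu_1)$ is the set of couplings $\pi$ of $\mu_0,\mu_1$ with $\pi(J)=1$. $\mathrm{OptGeo}^G(\mu_0,\mu_1)$ is the set of Borel probability measures $\nu$ on $C([0,1];H)$ with $(e_i)_\sharp\nu=\mu_i$, $i=0,1$ ($e_t$ evaluation at $t$), and $\nu(\mathrm{Caus}_G)=1$. $\mathrm{Ent}(\mu|\mathfrak m)=\int\rho\log\rho\,d\mathfrak m\in[-\infty,\infty)$ if $\mu=\rho\mathfrak m$ and $(\rho\log\rho)_+\in L^1(\mathfrak m)$, and $+\infty$ otherwise. $\mathrm U_{N-1}(\mu|\mathfrak m)=\exp(-\mathrm{Ent}(\mu|\mathfrak m)/(N-1))$ (equal to $0$ if $\mathrm{Ent}=+\infty$). $(H,G,\mathfrak m)$ satisfies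 $\mathsf{NC}^e(N)$ if for all Borel probability measures $\mu_0,\mu_1$ on $H$ with $\Pi_\le(\mu_0,\mu_1)\neq\emptyset$ there is $\nu\in\mathrm{OptGeo}^G(\mu_0,\mu_1)$ such that, with $\mu_t=(e_t)_\sharp\nu$, for all $t\in[0,1]$: $\mathrm U_{N-1}(\mu_t|\mathfrak m)\ge(1-t)\mathrm U_{N-1}(\mu_0|\mathfrak m)+t\,\mathrm U_{N-1}(\mu_1|\mathfrak m)$. *)

theory Defs
  imports "HOL-Probability.Probability"
begin

definition causal_space :: "('a \<Rightarrow> 'a \<Rightarrow> bool) \<Rightarrow> ('a \<Rightarrow> 'a \<Rightarrow> bool) \<Rightarrow> bool" where
  "causal_space ll le \<longleftrightarrow> reflp le \<and> transp le \<and> transp ll \<and> (\<forall>x y. ll x y \<longrightarrow> le x y)"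

text \<open>The class \<^class>\<open>polish_space\<close> supplies a complete metric inducing a separable topology;
  that metric is taken to be the proper one.\<close>

definition topological_causal_space ::
    "('a::polish_space \<Rightarrow> 'a \<Rightarrow> bool) \<Rightarrow> ('a \<Rightarrow> 'a \<Rightarrow> bool) \<Rightarrow> bool" where
  "topological_causal_space ll le \<longleftrightarrow>
     causal_space ll le \<and>
     (\<forall>(x::'a) r. compact (cball x r)) \<and>
     closed {(x, y). le x y} \<and>
     open {(x, y). ll x y}"

definition achronal :: "('a \<Rightarrow> 'a \<Rightarrow> bool) \<Rightarrow> 'a set \<Rightarrow> bool" where
  "achronal ll H \<longleftrightarrow> \<not> (\<exists>x\<in>H. \<exists>y\<in>H. ll x y)"

definition causal_curve ::
    "('a::topological_space \<Rightarrow> 'a \<Rightarrow> bool) \<Rightarrow> real set \<Rightarrow> (real \<Rightarrow> 'a) \<Rightarrow> bool" where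
  "causal_curve le I \<gamma> \<longleftrightarrow>
     is_interval I \<and> continuous_on I \<gamma> \<and> (\<forall>s\<in>I. \<forall>t\<in>I. s \<le> t \<longrightarrow> le (\<gamma> s) (\<gamma> t))"

definition initial_points :: "('a \<Rightarrow> 'a \<Rightarrow> bool) \<Rightarrow> 'a set \<Rightarrow> 'a set" where
  "initial_points le H = {m \<in> H. \<not> (\<exists>x\<in>H. le x m \<and> x \<noteq> m)}"

definition final_points :: "('a \<Rightarrow> 'a \<Rightarrow> bool) \<Rightarrow> 'a set \<Rightarrow> 'a set" where
  "final_points le H = {m \<in> H. \<not> (\<exists>x\<in>H. le m x \<and> x \<noteq> m)}"

definition static_points :: "('a \<Rightarrow> 'a \<Rightarrow> bool) \<Rightarrow> 'a set \<Rightarrow> 'a set" where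
  "static_points le H = initial_points le H \<inter> final_points le H"

definition causal_interior :: "('a \<Rightarrow> 'a \<Rightarrow> bool) \<Rightarrow> 'a set \<Rightarrow> 'a set" where
  "causal_interior le H = H - (initial_points le H \<union> final_points le H)"

text \<open>A gauge is a total function of which only the values on \<^term>\<open>causal_interior le H\<close> matter.
  Finiteness of the supremum and infimum is boundedness, the index set being nonempty.\<close>

definition gauge_for ::
    "('a::topological_space \<Rightarrow> 'a \<Rightarrow> bool) \<Rightarrow> 'a set \<Rightarrow> ('a \<Rightarrow> real) \<Rightarrow> bool" where
  "gauge_for le H G \<longleftrightarrow>
     G \<in> borel_measurable (restrict_space borel (causal_interior le H)) \<and>
     (\<forall>I \<gamma>. causal_curve le I \<gamma> \<and> inj_on \<gamma> I \<and> \<gamma> ` I \<subseteq> causal_interior le H \<longrightarrow>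
        strict_mono_on I (G \<circ> \<gamma>) \<and> continuous_on I (G \<circ> \<gamma>)) \<and>
     (\<forall>\<gamma>. causal_curve le {0..1} \<gamma> \<and> \<gamma> ` {0..1} \<subseteq> H \<and> \<gamma> ` {0<..<1} \<subseteq> causal_interior le H \<longrightarrow>
        bdd_above ((G \<circ> \<gamma>) ` {0<..<1}) \<and> bdd_below ((G \<circ> \<gamma>) ` {0<..<1}))"

text \<open>\<open>C([0,1];H)\<close> with the supremum metric; its elements are the continuous maps
  \<open>[0,1] \<rightarrow> H\<close>, extended by \<^const>\<open>undefined\<close> outside \<open>[0,1]\<close>.\<close>

definition curve_metric :: "'a::metric_space set \<Rightarrow> (real \<Rightarrow> 'a) metric" where
  "curve_metric H = cfunspace (top_of_set {0..1}) (submetric euclidean_metric H)"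

lemma mspace_curve_metric:
  "mspace (curve_metric H) =
     {\<gamma> \<in> extensional {0..1}. continuous_on {0..1} \<gamma> \<and> \<gamma> ` {0..1} \<subseteq> H}"
  unfolding curve_metric_def
  by (subst compactin_mspace_cfunspace)
     (auto simp: mtopology_of_submetric continuous_map_in_subtopology image_subset_iff compact_space_subtopology)

definition Caus ::
    "('a::metric_space \<Rightarrow> 'a \<Rightarrow> bool) \<Rightarrow> 'a set \<Rightarrow> ('a \<Rightarrow> real) \<Rightarrow> (real \<Rightarrow> 'a) set" where
  "Caus le H G =
     {\<gamma> \<in> mspace (curve_metric H).
        (\<exists>x. \<forall>t\<in>{0..1}. \<gamma> t = x) \<or>
        (causal_curve le {0..1} \<gamma> \<and> \<gamma> ` {0<..<1} \<subseteq> causal_interior le H \<and>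
         (\<exists>a b. \<forall>t\<in>{0<..<1}. G (\<gamma> t) = a * t + b))}"

definition tight_gauge ::
    "('a::metric_space \<Rightarrow> 'a \<Rightarrow> bool) \<Rightarrow> 'a set \<Rightarrow> ('a \<Rightarrow> real) \<Rightarrow> bool" where
  "tight_gauge le H G \<longleftrightarrow>
     (\<forall>x\<in>H. \<exists>U V. compact U \<and> U \<subseteq> H \<and> openin (top_of_set H) V \<and> x \<in> V \<and> V \<subseteq> U \<and>
        compactin (mtopology_of (curve_metric H)) {\<gamma> \<in> Caus le H G. \<gamma> 0 \<in> U \<and> \<gamma> 1 \<in> U})"

definition radon_measure_on :: "'a::topological_space set \<Rightarrow> 'a measure \<Rightarrow> bool" where
  "radon_measure_on H m \<longleftrightarrow>
     sets m = sets (restrict_space borel H) \<and>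
     (\<forall>x\<in>H. \<exists>V. openin (top_of_set H) V \<and> x \<in> V \<and> emeasure m V < \<infinity>) \<and>
     (\<forall>A\<in>sets m. emeasure m A = (SUP K\<in>{K. compact K \<and> K \<subseteq> A}. emeasure m K))"

definition synthetic_null_hypersurface ::
    "('a::topological_space \<Rightarrow> 'a \<Rightarrow> bool) \<Rightarrow> ('a \<Rightarrow> 'a \<Rightarrow> bool) \<Rightarrow>
     'a set \<Rightarrow> ('a \<Rightarrow> real) \<Rightarrow> 'a measure \<Rightarrow> bool" where
  "synthetic_null_hypersurface ll le H G m \<longleftrightarrow>
     closed H \<and> achronal ll H \<and> gauge_for le H G \<and> radon_measure_on H m \<and>
     static_points le H \<in> null_sets m"

definition borel_prob_on :: "'a::topological_space set \<Rightarrow> 'a measure \<Rightarrow> bool" where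
  "borel_prob_on H \<mu> \<longleftrightarrow> prob_space \<mu> \<and> sets \<mu> = sets (restrict_space borel H)"

definition causal_couplings ::
    "('a::topological_space \<Rightarrow> 'a \<Rightarrow> bool) \<Rightarrow> 'a set \<Rightarrow> 'a measure \<Rightarrow> 'a measure \<Rightarrow> ('a \<times> 'a) measure set" where
  "causal_couplings le H \<mu>0 \<mu>1 =
     {\<pi>. borel_prob_on (H \<times> H) \<pi> \<and>
         distr \<pi> (restrict_space borel H) fst = \<mu>0 \<and>
         distr \<pi> (restrict_space borel H) snd = \<mu>1 \<and>
         measure \<pi> {(x, y) \<in> H \<times> H. le x y} = 1}"

definition curve_borel :: "'a::metric_space set \<Rightarrow> (real \<Rightarrow> 'a) measure" where
  "curve_borel H =
     sigma (mspace (curve_metric H)) {U. openin (mtopology_of (curve_metric H)) U}"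

definition eval_push :: "'a::metric_space set \<Rightarrow> real \<Rightarrow> (real \<Rightarrow> 'a) measure \<Rightarrow> 'a measure" where
  "eval_push H t \<nu> = distr \<nu> (restrict_space borel H) (\<lambda>\<gamma>. \<gamma> t)"

definition OptGeo ::
    "('a::metric_space \<Rightarrow> 'a \<Rightarrow> bool) \<Rightarrow> 'a set \<Rightarrow> ('a \<Rightarrow> real) \<Rightarrow>
     'a measure \<Rightarrow> 'a measure \<Rightarrow> (real \<Rightarrow> 'a) measure set" where
  "OptGeo le H G \<mu>0 \<mu>1 =
     {\<nu>. prob_space \<nu> \<and> sets \<nu> = sets (curve_borel H) \<and>
         eval_push H 0 \<nu> = \<mu>0 \<and> eval_push H 1 \<nu> = \<mu>1 \<and>
         measure \<nu> (Caus le H G) = 1}"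

text \<open>\<^const>\<open>ennreal\<close> truncates negative numbers to \<open>0\<close>, so the two integrals are those of the
  positive and the negative part of \<open>\<rho> log \<rho>\<close>; the value is \<open>-\<infinity>\<close> when the second one diverges.\<close>

definition Ent :: "'a measure \<Rightarrow> 'a measure \<Rightarrow> ereal" where
  "Ent \<mu> m =
     (let \<rho> = (\<lambda>x. enn2real (RN_deriv m \<mu> x));
          P = (\<integral>\<^sup>+ x. ennreal (\<rho> x * ln (\<rho> x)) \<partial>m);
          Q = (\<integral>\<^sup>+ x. ennreal (- (\<rho> x * ln (\<rho> x))) \<partial>m)
      in if density m (RN_deriv m \<mu>) = \<mu> \<and> P < \<infinity> then enn2ereal P - enn2ereal Q else \<infinity>)"

fun exp_ereal :: "ereal \<Rightarrow> ennreal" where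
  "exp_ereal (ereal r) = ennreal (exp r)"
| "exp_ereal PInfty = \<infinity>"
| "exp_ereal MInfty = 0"

definition U_ent :: "real \<Rightarrow> 'a measure \<Rightarrow> 'a measure \<Rightarrow> ennreal" where
  "U_ent n \<mu> m = exp_ereal (- Ent \<mu> m / ereal n)"

text \<open>The inequality is one in \<open>[0,\<infinity>]\<close> with \<open>0 \<cdot> \<infinity> = 0\<close>.\<close>

definition NCe ::
    "('a::metric_space \<Rightarrow> 'a \<Rightarrow> bool) \<Rightarrow> 'a set \<Rightarrow> ('a \<Rightarrow> real) \<Rightarrow> 'a measure \<Rightarrow> real \<Rightarrow> bool" where
  "NCe le H G m N \<longleftrightarrow>
     (\<forall>\<mu>0 \<mu>1. borel_prob_on H \<mu>0 \<and> borel_prob_on H \<mu>1 \<and> causal_couplings le H \<mu>0 \<mu>1 \<noteq> {} \<longrightarrow>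
        (\<exists>\<nu>\<in>OptGeo le H G \<mu>0 \<mu>1. \<forall>t\<in>{0..1}.
           U_ent (N - 1) (eval_push H t \<nu>) m \<ge>
             ennreal (1 - t) * U_ent (N - 1) \<mu>0 m + ennreal t * U_ent (N - 1) \<mu>1 m))"

end

theory Submission
  imports Defs
begin

text \<open>Suppose the initial points that are not final form a non-null set. Pick
  a compact part \<open>K\<close> of positive finite measure and move its normalised measure a little to
  the causal future, off \<open>K\<close>, by a Borel selection. The interpolating curves leave \<open>K\<close>
  immediately, because their interior points are neither initial nor final, while tightness makes
  them equicontinuous. So at small times all mass lies in an arbitrarily thin neighbourhood of \<open>K\<close>
  with \<open>K\<close> removed, a set of arbitrarily small measure, and the entropy tends to infinity. The
  null energy condition bounds that entropy, a contradiction. Final points are treated in the same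
  way from the other end of the curves.\<close>

text \<open>The mass is moved only a little because tightness is local: a common modulus of
  continuity is available only for curves with both ends in one compact neighbourhood. That causally
  related points exist nearby is not part of the definitions. It comes from the null energy
  condition itself, applied to Dirac masses, whose interpolating curves can be stopped early.
  Compactness of \<open>K\<close> makes the thin neighbourhoods with \<open>K\<close> removed shrink
  to the empty set inside a region of finite measure. An arbitrary Borel selection suffices as
  target: its contribution to the right-hand side of the entropy inequality is nonnegative and is
  discarded, so its image measure may be singular. The normalised measure on \<open>K\<close> has
  finite entropy, which keeps the other term positive, with weight at least 1/2 at times within 1/2
  of the end where it sits.\<close>

section \<open>Borel selection from a compact relation\<close>

lemma decseq_compact_Inter_nonempty:
  fixes K :: "nat \<Rightarrow> 'a::t2_space set"
  assumes comp: "\<And>n. compact (K n)" and ne: "\<And>n. K n \<noteq> {}" and dec: "decseq K"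
  shows "(\<Inter>n. K n) \<noteq> {}"
proof -
  have "K 0 \<inter> (\<Inter>n\<in>UNIV. K n) \<noteq> {}"
  proof (rule compact_imp_fip_image)
    fix I :: "nat set" assume "finite I"
    then have "K (Max (insert 0 I)) \<subseteq> K 0 \<inter> (\<Inter>n\<in>I. K n)"
      by (intro Int_greatest INT_greatest decseqD[OF dec] Max_ge) auto
    then show "K 0 \<inter> (\<Inter>n\<in>I. K n) \<noteq> {}"
      using ne by blast
  qed (use comp compact_imp_closed in auto)
  then show ?thesis by blast
qed

text \<open>The fibre of \<open>C\<close> over \<open>x\<close> is cut down by minimising successively the distances to the points
  of a dense sequence. Each step keeps the property that the set of \<open>x\<close> whose fibre meets a given
  closed set is Borel, and since these distances separate points a single point is left.\<close>

lemma compact_Borel_selection: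
  fixes C :: "('a::t2_space \<times> 'b::{metric_space, second_countable_topology}) set"
  assumes C: "compact C"
  obtains T where "T \<in> borel_measurable (restrict_space borel (fst ` C))"
    "\<And>x. x \<in> fst ` C \<Longrightarrow> (x, T x) \<in> C"
proof -
  define K where "K = fst ` C"
  obtain D :: "'b set" where D: "countable D" "D \<noteq> {}"
      "\<And>U. open U \<Longrightarrow> U \<noteq> {} \<Longrightarrow> \<exists>d\<in>D. d \<in> U"
    using countable_dense_exists[where 'a='b] by blast
  define f where "f n y = dist y (from_nat_into D n)" for n y
  have cf: "continuous_on S (f n)" for S n
    unfolding f_def by (intro continuous_intros)
  have sep: "y = z" if "\<And>n. f n y = f n z" for y z
  proof (rule ccontr)
    assume "y \<noteq> z"
    then have "ball y (dist y z / 2) \<noteq> {}" by auto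
    then obtain d where d: "d \<in> D" "dist y d < dist y z / 2"
      using D(3)[of "ball y (dist y z / 2)"] by auto
    then obtain n where "d = from_nat_into D n"
      using D(1) by (metis from_nat_into_to_nat_on)
    then have "dist z d = dist y d" using that[of n] by (simp add: f_def)
    then show False using d(2) dist_triangle_half_r[of y d "dist y z" z] d
      by (metis dist_commute dist_triangle_half_r less_irrefl)
  qed
  define \<Gamma> where "\<Gamma> = rec_nat (\<lambda>x. {y. (x, y) \<in> C})
    (\<lambda>n \<Gamma>n x. {y \<in> \<Gamma>n x. \<forall>z\<in>\<Gamma>n x. f n y \<le> f n z})"
  have \<Gamma>0: "\<Gamma> 0 x = {y. (x, y) \<in> C}" for x by (simp add: \<Gamma>_def)
  have \<Gamma>S: "\<Gamma> (Suc n) x = {y \<in> \<Gamma> n x. \<forall>z\<in>\<Gamma> n x. f n y \<le> f n z}" for n x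
    by (simp add: \<Gamma>_def)
  have comp: "compact (\<Gamma> n x) \<and> \<Gamma> n x \<noteq> {}" if x: "x \<in> K" for n x
  proof (induction n)
    case 0
    have "\<Gamma> 0 x = snd ` (C \<inter> {x} \<times> UNIV)" by (force simp: \<Gamma>0 image_iff)
    moreover have "compact (C \<inter> {x} \<times> UNIV)"
      by (intro compact_Int_closed C closed_Times) auto
    ultimately show ?case
      using x by (auto simp: K_def intro!: compact_continuous_image continuous_intros)
  next
    case (Suc n)
    then obtain y0 where y0: "y0 \<in> \<Gamma> n x" "\<And>z. z \<in> \<Gamma> n x \<Longrightarrow> f n y0 \<le> f n z"
      using continuous_attains_inf[OF _ _ cf, of "\<Gamma> n x" n] by blast
    then have eq: "\<Gamma> (Suc n) x = \<Gamma> n x \<inter> {y. f n y \<le> f n y0}"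
      by (force simp: \<Gamma>S)
    have "closed {y. f n y \<le> f n y0}"
      by (intro closed_Collect_le cf continuous_on_const)
    then show ?case using Suc y0 eq by (auto intro: compact_Int_closed)
  qed
  have meas: "{x \<in> K. \<Gamma> n x \<inter> F \<noteq> {}} \<in> sets borel" if "closed F" for n F
    using that
  proof (induction n arbitrary: F)
    case 0
    have "{x \<in> K. \<Gamma> 0 x \<inter> F \<noteq> {}} = fst ` (C \<inter> UNIV \<times> F)"
      by (force simp: \<Gamma>0 K_def image_iff)
    moreover have "compact (fst ` (C \<inter> UNIV \<times> F))"
      by (intro compact_continuous_image continuous_intros compact_Int_closed C closed_Times 0 closed_UNIV)
    ultimately show ?case by (simp add: compact_imp_closed)
  next
    case (Suc n)
    define L where "L q = {y. f n y \<le> q}" for q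
    have cL: "closed (L q)" for q
      unfolding L_def by (intro closed_Collect_le cf continuous_on_const)
    \<comment> \<open>A minimiser over \<open>\<Gamma> n x\<close> lies in \<open>F\<close> exactly
      when \<open>f n\<close> gets as low on \<open>\<Gamma> n x \<inter> F\<close> as on all of
      \<open>\<Gamma> n x\<close>. If it does not, a rational \<open>q\<close> separates the two
      minima, so countably many sublevel sets detect every failure.\<close>
    have eq: "{x \<in> K. \<Gamma> (Suc n) x \<inter> F \<noteq> {}} = {x \<in> K. \<Gamma> n x \<inter> F \<noteq> {}} -
      (\<Union>q\<in>\<rat>. {x \<in> K. \<Gamma> n x \<inter> L q \<noteq> {}} - {x \<in> K. \<Gamma> n x \<inter> (F \<inter> L q) \<noteq> {}})" (is "?l = ?r")
    proof (rule set_eqI, rule iffI)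
      fix x assume "x \<in> ?l"
      then show "x \<in> ?r" by (fastforce simp: \<Gamma>S L_def)
    next
      fix x assume x: "x \<in> ?r"
      then have "compact (\<Gamma> n x \<inter> F)" "\<Gamma> n x \<inter> F \<noteq> {}"
        using comp Suc.prems by (auto intro: compact_Int_closed)
      then obtain y where y: "y \<in> \<Gamma> n x" "y \<in> F" "\<And>z. z \<in> \<Gamma> n x \<inter> F \<Longrightarrow> f n y \<le> f n z"
        using continuous_attains_inf[OF _ _ cf, of "\<Gamma> n x \<inter> F" n] by blast
      have "f n y \<le> f n z" if z: "z \<in> \<Gamma> n x" for z
      proof (rule ccontr)
        assume "\<not> f n y \<le> f n z"
        then obtain q where q: "q \<in> \<rat>" "f n z < q" "q < f n y"
          using Rats_dense_in_real by (metis not_le)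
        then have "\<Gamma> n x \<inter> L q \<noteq> {}" using z by (auto simp: L_def)
        then have "\<Gamma> n x \<inter> (F \<inter> L q) \<noteq> {}" using x q(1) by blast
        then show False using y(3) q by (force simp: L_def)
      qed
      then show "x \<in> ?l" using x y by (auto simp: \<Gamma>S)
    qed
    show ?case unfolding eq
      by (intro sets.Diff sets.countable_UN'' Suc closed_Int cL countable_rat)
  qed
  have dec: "decseq (\<lambda>n. \<Gamma> n x)" for x
    by (rule decseq_SucI) (auto simp: \<Gamma>S)
  have single: "y = z" if y: "y \<in> (\<Inter>n. \<Gamma> n x)" and z: "z \<in> (\<Inter>n. \<Gamma> n x)" for x y z
  proof (rule sep)
    fix n
    have "y \<in> \<Gamma> (Suc n) x" "z \<in> \<Gamma> (Suc n) x" using y z by blast+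
    then show "f n y = f n z" by (auto simp: \<Gamma>S intro: antisym)
  qed
  define T where "T x = (SOME y. y \<in> (\<Inter>n. \<Gamma> n x))" for x
  have T: "T x \<in> (\<Inter>n. \<Gamma> n x)" if "x \<in> K" for x
  proof -
    have "(\<Inter>n. \<Gamma> n x) \<noteq> {}"
      using comp[OF that] dec by (intro decseq_compact_Inter_nonempty) auto
    then show ?thesis unfolding T_def some_in_eq .
  qed
  have pre: "{x \<in> K. T x \<in> F} \<in> sets borel" if F: "closed F" for F
  proof -
    \<comment> \<open>If every \<open>\<Gamma> n x\<close> meets \<open>F\<close>, compactness puts
      a point of \<open>F\<close> into their intersection, and that point can only be
      \<open>T x\<close>. Membership of the limit thus reduces to the countably many conditions
      already known to be Borel.\<close>
    have "{x \<in> K. T x \<in> F} = (\<Inter>n. {x \<in> K. \<Gamma> n x \<inter> F \<noteq> {}})"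
    proof (intro set_eqI iffI)
      fix x assume x: "x \<in> (\<Inter>n. {x \<in> K. \<Gamma> n x \<inter> F \<noteq> {}})"
      then have xK: "x \<in> K" by blast
      have "(\<Inter>n. \<Gamma> n x \<inter> F) \<noteq> {}"
        using comp[OF xK] x F dec[of x]
        by (intro decseq_compact_Inter_nonempty) (auto intro: compact_Int_closed simp: decseq_def)
      then obtain y where "y \<in> (\<Inter>n. \<Gamma> n x)" "y \<in> F" by blast
      then show "x \<in> {x \<in> K. T x \<in> F}" using single[OF T[OF xK]] xK by blast
    qed (use T in blast)
    then show ?thesis using meas[OF F] by auto
  qed
  have "compact K" unfolding K_def
    by (intro compact_continuous_image continuous_intros C)
  then have Kb: "K \<in> sets borel" by (simp add: compact_imp_closed)
  show ?thesis
  proof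
    show "T \<in> borel_measurable (restrict_space borel (fst ` C))"
      unfolding K_def[symmetric]
    proof (subst borel_eq_closed, rule measurable_measure_of)
      fix F :: "'b set" assume "F \<in> Collect closed"
      then have "{x \<in> K. T x \<in> F} \<in> sets borel" by (intro pre) simp
      moreover have "T -` F \<inter> space (restrict_space borel K) = {x \<in> K. T x \<in> F}"
        by (auto simp: space_restrict_space)
      ultimately show "T -` F \<inter> space (restrict_space borel K) \<in> sets (restrict_space borel K)"
        using Kb by (simp add: sets_restrict_space_iff)
    qed auto
    show "(x, T x) \<in> C" if "x \<in> fst ` C" for x
      using INT_D[OF T[of x], of 0] that by (simp add: K_def \<Gamma>0)
  qed
qed

section \<open>The space of curves: evaluation and equicontinuity\<close>

lemma curve_metric_dist_le:
  assumes "\<gamma> \<in> mspace (curve_metric H)" "\<delta> \<in> mspace (curve_metric H)" "t \<in> {0..1}"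
  shows "dist (\<gamma> t) (\<delta> t) \<le> mdist (curve_metric H) \<gamma> \<delta>"
  using mdist_cfunspace_imp_mdist_le[of \<gamma> "top_of_set {0..1}" "submetric euclidean_metric H" \<delta>, OF _ _ order_refl]
    assms by (simp add: curve_metric_def)

lemma space_curve_borel: "space (curve_borel H) = mspace (curve_metric H)"
  unfolding curve_borel_def by (rule space_measure_of_conv)

lemma sets_curve_borelI:
  assumes "openin (mtopology_of (curve_metric H)) U"
  shows "U \<in> sets (curve_borel H)"
  unfolding curve_borel_def
  using assms openin_subset[of "mtopology_of (curve_metric H)"]
  by (subst sets_measure_of) auto

text \<open>Evaluation is 1-Lipschitz for the supremum metric, hence continuous. This is what makes
  \<open>eval_push\<close> a genuine push-forward.\<close>

lemma measurable_eval:
  fixes H :: "'a::metric_space set"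
  assumes t: "t \<in> {0..1}"
  shows "(\<lambda>\<gamma>. \<gamma> t) \<in> curve_borel H \<rightarrow>\<^sub>M restrict_space borel H"
proof (rule measurable_restrict_space2)
  show "(\<lambda>\<gamma>. \<gamma> t) \<in> space (curve_borel H) \<rightarrow> H"
    using t by (auto simp: space_curve_borel mspace_curve_metric)
  show "(\<lambda>\<gamma>. \<gamma> t) \<in> borel_measurable (curve_borel H)"
  proof (rule borel_measurableI)
    fix S :: "'a set" assume S: "open S"
    interpret M: Metric_space "mspace (curve_metric H)" "mdist (curve_metric H)"
      by (rule Metric_space_mspace_mdist)
    have "openin M.mtopology ((\<lambda>\<gamma>. \<gamma> t) -` S \<inter> mspace (curve_metric H))"
      unfolding M.openin_mtopology
    proof (intro conjI allI impI)
      fix \<gamma> assume g: "\<gamma> \<in> (\<lambda>\<gamma>. \<gamma> t) -` S \<inter> mspace (curve_metric H)"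
      then obtain r where r: "r > 0" "ball (\<gamma> t) r \<subseteq> S"
        using S by (auto elim: openE)
      have "M.mball \<gamma> r \<subseteq> (\<lambda>\<gamma>. \<gamma> t) -` S \<inter> mspace (curve_metric H)"
      proof
        fix \<delta> assume "\<delta> \<in> M.mball \<gamma> r"
        then have "\<delta> \<in> mspace (curve_metric H)" "mdist (curve_metric H) \<gamma> \<delta> < r" by auto
        then show "\<delta> \<in> (\<lambda>\<gamma>. \<gamma> t) -` S \<inter> mspace (curve_metric H)"
          using curve_metric_dist_le[of \<gamma> H \<delta> t] g t r(2) by force
      qed
      then show "\<exists>r>0. M.mball \<gamma> r \<subseteq> (\<lambda>\<gamma>. \<gamma> t) -` S \<inter> mspace (curve_metric H)"
        using r(1) by blast
    qed auto
    then show "(\<lambda>\<gamma>. \<gamma> t) -` S \<inter> space (curve_borel H) \<in> sets (curve_borel H)"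
      unfolding space_curve_borel by (intro sets_curve_borelI) (simp add: mtopology_of_def)
  qed
qed

text \<open>The easy half of Arzela-Ascoli: a finite \<epsilon>/3-net of uniformly continuous curves
  passes its smallest modulus on to the whole family. Tightness enters the main argument through
  this lemma.\<close>

lemma compact_curves_equicontinuous:
  assumes F: "compactin (mtopology_of (curve_metric H)) F" and e: "\<epsilon> > 0"
  obtains \<tau> where "\<tau> > 0"
    "\<forall>\<gamma>\<in>F. \<forall>s\<in>{0..1}. \<forall>t\<in>{0..1}. \<bar>s - t\<bar> < \<tau> \<longrightarrow> dist (\<gamma> s) (\<gamma> t) < \<epsilon>"
proof -
  interpret M: Metric_space "mspace (curve_metric H)" "mdist (curve_metric H)"
    by (rule Metric_space_mspace_mdist)
  have "M.mtotally_bounded F"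
    using F M.compactin_imp_mtotally_bounded by (simp add: mtopology_of_def)
  then obtain L where L: "finite L" "L \<subseteq> F" "F \<subseteq> (\<Union>\<gamma>\<in>L. M.mball \<gamma> (\<epsilon> / 3))"
    using e unfolding M.mtotally_bounded_def by (meson zero_less_divide_iff zero_less_numeral)
  have Fm: "F \<subseteq> mspace (curve_metric H)"
    using compactin_subset_topspace[OF F] by simp
  have "\<exists>\<tau>>0. \<forall>s\<in>{0..1}. \<forall>t\<in>{0..1}. \<bar>s - t\<bar> < \<tau> \<longrightarrow> dist (\<gamma> s) (\<gamma> t) < \<epsilon> / 3" if "\<gamma> \<in> L" for \<gamma>
  proof -
    have "uniformly_continuous_on {0..1} \<gamma>"
      using that L(2) Fm by (intro compact_uniformly_continuous) (auto simp: mspace_curve_metric)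
    then show ?thesis
      using e unfolding uniformly_continuous_on_def
      by (metis dist_commute dist_real_def zero_less_divide_iff zero_less_numeral)
  qed
  then obtain \<tau> where \<tau>: "\<And>\<gamma>. \<gamma> \<in> L \<Longrightarrow> \<tau> \<gamma> > 0"
    "\<And>\<gamma> s t. \<gamma> \<in> L \<Longrightarrow> s \<in> {0..1} \<Longrightarrow> t \<in> {0..1} \<Longrightarrow> \<bar>s - t\<bar> < \<tau> \<gamma> \<Longrightarrow> dist (\<gamma> s) (\<gamma> t) < \<epsilon> / 3"
    by metis
  show ?thesis
  proof
    \<comment> \<open>The inserted \<open>1\<close> keeps the minimum meaningful when the net is
      empty.\<close>
    show "Min (insert 1 (\<tau> ` L)) > 0" using L(1) \<tau>(1) by auto
    show "\<forall>\<gamma>\<in>F. \<forall>s\<in>{0..1}. \<forall>t\<in>{0..1}. \<bar>s - t\<bar> < Min (insert 1 (\<tau> ` L)) \<longrightarrow> dist (\<gamma> s) (\<gamma> t) < \<epsilon>"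
    proof (intro ballI impI)
      fix \<gamma> and s t :: real
      assume g: "\<gamma> \<in> F" and st: "s \<in> {0..1}" "t \<in> {0..1}" "\<bar>s - t\<bar> < Min (insert 1 (\<tau> ` L))"
      from g L(3) obtain \<delta> where d: "\<delta> \<in> L" "mdist (curve_metric H) \<delta> \<gamma> < \<epsilon> / 3" by auto
      have "dist (\<delta> u) (\<gamma> u) < \<epsilon> / 3" if "u \<in> {0..1}" for u
        using curve_metric_dist_le[of \<delta> H \<gamma> u] d that g L(2) Fm by force
      then have "dist (\<delta> s) (\<gamma> s) < \<epsilon> / 3" "dist (\<delta> t) (\<gamma> t) < \<epsilon> / 3" using st by auto
      moreover have "dist (\<delta> s) (\<delta> t) < \<epsilon> / 3"
        using st L(1) d(1) by (intro \<tau>(2)) auto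
      ultimately show "dist (\<gamma> s) (\<gamma> t) < \<epsilon>"
        by metric
    qed
  qed
qed

section \<open>Entropy bounds\<close>

text \<open>The right-hand side is the tangent at \<open>c\<close> of the convex function
  \<open>x * ln x\<close>. Integrating this line takes the place of Jensen's inequality.\<close>

lemma mult_ln_ge:
  fixes x c :: real
  assumes "x \<ge> 0" "c > 0"
  shows "x * ln x \<ge> x * ln c + x - c"
proof (cases "x = 0")
  case False
  then have x: "x > 0" using assms by simp
  have "ln (c / x) \<le> c / x - 1" using x assms by (intro ln_le_minus_one) auto
  then have "x * (ln c - ln x) \<le> x * (c / x - 1)"
    using x assms by (simp add: ln_div)
  then show ?thesis using x by (simp add: algebra_simps)
qed (use assms in auto)

text \<open>An integrable minorant forces the negative part to have finite integral, so the extended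
  difference is an ordinary Lebesgue integral and monotonicity applies.\<close>

lemma ereal_nn_integral_diff_ge:
  fixes f g :: "'a \<Rightarrow> real"
  assumes [measurable]: "f \<in> borel_measurable M" and g: "integrable M g"
    and le: "AE x in M. g x \<le> f x"
    and P: "(\<integral>\<^sup>+ x. ennreal (f x) \<partial>M) < \<infinity>"
  shows "enn2ereal (\<integral>\<^sup>+ x. ennreal (f x) \<partial>M) - enn2ereal (\<integral>\<^sup>+ x. ennreal (- f x) \<partial>M)
    \<ge> ereal (integral\<^sup>L M g)"
proof -
  have "(\<integral>\<^sup>+ x. ennreal (- f x) \<partial>M) \<le> (\<integral>\<^sup>+ x. ennreal (- g x) \<partial>M)"
    using le by (intro nn_integral_mono_AE) (auto elim!: eventually_mono intro: ennreal_leI)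
  also have "\<dots> < \<infinity>"
    using g by (simp add: real_integrable_def top.not_eq_extremum)
  finally have Q: "(\<integral>\<^sup>+ x. ennreal (- f x) \<partial>M) < \<infinity>" .
  then have f: "integrable M f" using P by (simp add: real_integrable_def less_top)
  have "integral\<^sup>L M g \<le> integral\<^sup>L M f"
    using f g le by (intro integral_mono_AE)
  also have "\<dots> = enn2real (\<integral>\<^sup>+ x. ennreal (f x) \<partial>M) - enn2real (\<integral>\<^sup>+ x. ennreal (- f x) \<partial>M)"
    by (rule real_lebesgue_integral_def[OF f])
  finally have *: "ereal (integral\<^sup>L M g) \<le> ereal (\<dots>)" by simp
  have "enn2ereal A = ereal (enn2real A)" if "A < \<infinity>" for A
    using that by (metis enn2ereal_ennreal enn2real_nonneg ennreal_enn2real infinity_ennreal_def)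
  then show ?thesis using * P Q by simp
qed

text \<open>Mass squeezed into a small set has large entropy. Without a density, or with a divergent
  positive part, the entropy is infinite by definition. Otherwise the tangent is taken at
  \<open>1 / \<delta>\<close>, the density of a uniform distribution on a set of measure
  \<delta>.\<close>

lemma Ent_ge_neg_ln:
  assumes \<mu>: "prob_space \<mu>" "sets \<mu> = sets m"
    and A: "A \<in> sets m" "emeasure \<mu> A = 1" "emeasure m A \<le> ennreal \<delta>" and d: "\<delta> > 0"
  shows "Ent \<mu> m \<ge> ereal (- ln \<delta>)"
proof (cases "density m (RN_deriv m \<mu>) = \<mu>
    \<and> (\<integral>\<^sup>+ x. ennreal (enn2real (RN_deriv m \<mu> x) * ln (enn2real (RN_deriv m \<mu> x))) \<partial>m) < \<infinity>")
  case True
  interpret \<mu>: prob_space \<mu> by fact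
  define r where "r x = enn2real (RN_deriv m \<mu> x)" for x
  have [measurable]: "r \<in> borel_measurable m" unfolding r_def by measurable
  have eq: "density m (RN_deriv m \<mu>) = \<mu>" using True by simp
  have tot: "(\<integral>\<^sup>+ x. RN_deriv m \<mu> x \<partial>m) = 1"
  proof -
    have "emeasure (density m (RN_deriv m \<mu>)) (space m) = (\<integral>\<^sup>+ x. RN_deriv m \<mu> x * indicator (space m) x \<partial>m)"
      by (rule emeasure_density) auto
    also have "\<dots> = (\<integral>\<^sup>+ x. RN_deriv m \<mu> x \<partial>m)"
      by (intro nn_integral_cong) simp
    finally show ?thesis
      using \<mu>.emeasure_space_1 sets_eq_imp_space_eq[OF \<mu>(2)] eq by simp
  qed
  have "AE x in m. RN_deriv m \<mu> x \<noteq> \<infinity>"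
    using tot by (intro nn_integral_PInf_AE) auto
  then have fin: "AE x in m. ennreal (r x) = RN_deriv m \<mu> x"
    by eventually_elim (auto simp: r_def less_top)
  have "AE x in \<mu>. x \<in> A"
    using A \<mu> by (intro \<mu>.AE_in_set_eq_1[THEN iffD2]) (auto simp: measure_def)
  then have "AE x in density m (RN_deriv m \<mu>). x \<in> A"
    unfolding eq .
  then have "AE x in m. 0 < RN_deriv m \<mu> x \<longrightarrow> x \<in> A"
    by (simp add: AE_density)
  then have out: "AE x in m. x \<notin> A \<longrightarrow> r x = 0"
    by eventually_elim (auto simp: r_def zero_less_iff_neq_zero)
  have int_r: "(\<integral>\<^sup>+ x. ennreal (r x) \<partial>m) = 1"
    using tot nn_integral_cong_AE[OF fin] by simp
  have r: "integrable m r" "integral\<^sup>L m r = 1"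
    using int_r by (auto simp: integral_eq_nn_integral r_def intro!: integrableI_nonneg)
  have Afin: "emeasure m A < \<infinity>"
    using A(3) by (simp add: le_less_trans)
  \<comment> \<open>The constant term of the tangent is cut off outside \<open>A\<close>, since
    \<open>m\<close> may be infinite there. The bound survives because \<open>r\<close> vanishes
    almost everywhere off \<open>A\<close>, where both sides are then 0.\<close>
  define g where "g x = r x * ln (1 / \<delta>) + r x - 1 / \<delta> * indicator A x" for x
  have g: "integrable m g" unfolding g_def
    using r A Afin by (intro Bochner_Integration.integrable_add Bochner_Integration.integrable_diff
      integrable_mult_left integrable_mult_right integrable_real_indicator) auto
  have "integral\<^sup>L m g = ln (1 / \<delta>) + 1 - 1 / \<delta> * measure m A"
    unfolding g_def using r A Afin by (simp add: integrable_real_indicator)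
  moreover have "measure m A \<le> \<delta>"
    unfolding measure_def using A(3) d by (simp add: enn2real_leI)
  then have "1 / \<delta> * measure m A \<le> 1" using d by (simp add: field_simps)
  ultimately have g_ge: "integral\<^sup>L m g \<ge> - ln \<delta>"
    using d by (simp add: ln_div)
  have "AE x in m. g x \<le> r x * ln (r x)"
    using out
  proof eventually_elim
    fix x assume "x \<notin> A \<longrightarrow> r x = 0"
    then show "g x \<le> r x * ln (r x)"
      using mult_ln_ge[of "r x" "1 / \<delta>"] d by (cases "x \<in> A") (auto simp: g_def r_def)
  qed
  then have "ereal (integral\<^sup>L m g) \<le> Ent \<mu> m"
    using True ereal_nn_integral_diff_ge[OF _ g, of "\<lambda>x. r x * ln (r x)"]
    by (simp add: Ent_def Let_def r_def)
  then show ?thesis using g_ge by (meson ereal_less_eq(3) order_trans)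
qed (auto simp: Ent_def Let_def)

lemma exp_ereal_infinity: "exp_ereal \<infinity> = \<infinity>" "exp_ereal (- \<infinity>) = 0"
  by (metis exp_ereal.simps(2) infinity_ereal_def) (metis exp_ereal.simps(3) MInfty_eq_minfinity)

lemma U_ent_le:
  assumes "n > 0" "Ent \<mu> m \<ge> ereal c"
  shows "U_ent n \<mu> m \<le> ennreal (exp (- c / n))"
  using assms by (cases "Ent \<mu> m") (auto simp: U_ent_def exp_ereal_infinity divide_right_mono intro!: ennreal_leI)

lemma U_ent_pos:
  assumes "n > 0" "Ent \<mu> m < \<infinity>"
  shows "U_ent n \<mu> m > 0"
  using assms by (cases "Ent \<mu> m") (auto simp: U_ent_def exp_ereal_infinity)

text \<open>Sigma-finiteness identifies the Radon-Nikodym derivative with the constant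
  \<open>1 / measure m K\<close> on \<open>K\<close>, so the positive part integrates to a finite
  value. With \<open>U_ent_pos\<close> this makes the lower bound in the energy condition strictly
  positive.\<close>

lemma Ent_uniform_measure_finite:
  assumes m: "sigma_finite_measure m" and K: "K \<in> sets m" "emeasure m K \<noteq> 0" "emeasure m K \<noteq> \<infinity>"
  shows "Ent (uniform_measure m K) m < \<infinity>"
proof -
  interpret sigma_finite_measure m by fact
  define c where "c = 1 / measure m K"
  have ae: "AE x in m. indicator K x / emeasure m K = RN_deriv m (uniform_measure m K) x"
    using K by (intro RN_deriv_unique) (auto simp: uniform_measure_def)
  have em: "emeasure m K = ennreal (measure m K)"
    using K by (simp add: emeasure_eq_ennreal_measure)
  then have em_pos: "measure m K > 0"
    using K by (metis ennreal_0 measure_nonneg order_le_less)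
  have d: "density m (RN_deriv m (uniform_measure m K)) = uniform_measure m K"
    using K unfolding uniform_measure_def by (intro density_RN_deriv_density) auto
  have "(\<integral>\<^sup>+ x. ennreal (enn2real (RN_deriv m (uniform_measure m K) x) * ln (enn2real (RN_deriv m (uniform_measure m K) x))) \<partial>m)
     = (\<integral>\<^sup>+ x. ennreal (c * ln c) * indicator K x \<partial>m)"
  proof (rule nn_integral_cong_AE, use ae in eventually_elim)
    fix x assume e: "indicator K x / emeasure m K = RN_deriv m (uniform_measure m K) x"
    have "enn2real (RN_deriv m (uniform_measure m K) x) = c * indicator K x"
      unfolding e[symmetric] em c_def using em_pos K
      by (auto simp: indicator_def divide_ennreal simp flip: ennreal_1)
    then show "ennreal (enn2real (RN_deriv m (uniform_measure m K) x) * ln (enn2real (RN_deriv m (uniform_measure m K) x)))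
      = ennreal (c * ln c) * indicator K x" by (auto simp: indicator_def)
  qed
  also have "\<dots> < \<infinity>"
    using K by (simp add: nn_integral_cmult_indicator ennreal_mult_less_top less_top)
  finally have fin: "(\<integral>\<^sup>+ x. ennreal (enn2real (RN_deriv m (uniform_measure m K) x) * ln (enn2real (RN_deriv m (uniform_measure m K) x))) \<partial>m) < \<infinity>" .
  have "enn2ereal P - enn2ereal Q < \<infinity>" if "P < \<infinity>" for P Q
    using that enn2ereal_nonneg[of Q] by (cases P; cases "enn2ereal Q") auto
  then show ?thesis using d fin by (simp add: Ent_def Let_def)
qed

section \<open>Borel measurability of initial and final points\<close>

text \<open>A projection of a Borel set need not be Borel. Here properness exhausts the off-diagonal
  part of \<open>E\<close> by countably many compact sets, bounded and at distance at least
  \<open>1 / real (Suc n)\<close> from coincidence, and their projections are compact. The point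
  \<open>undefined\<close> is just an arbitrary centre for the balls.\<close>

lemma sets_Collect_related_distinct:
  fixes E :: "('a::metric_space \<times> 'a) set"
  assumes proper: "\<And>(x::'a) r. compact (cball x r)" and E: "closed E"
  shows "{x. \<exists>y. (x, y) \<in> E \<and> y \<noteq> x} \<in> sets borel"
proof -
  define C where "C n = E \<inter> cball undefined (real n) \<times> cball undefined (real n)
      \<inter> {(x, y). dist x y \<ge> 1 / real (Suc n)}" for n
  have "{x. \<exists>y. (x, y) \<in> E \<and> y \<noteq> x} = (\<Union>n. fst ` C n)"
  proof (intro set_eqI iffI)
    fix x assume "x \<in> {x. \<exists>y. (x, y) \<in> E \<and> y \<noteq> x}"
    then obtain y where y: "(x, y) \<in> E" "y \<noteq> x" by blast
    obtain n where n: "1 / real (Suc n) < dist x y"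
      using y(2) nat_approx_posE[of "dist x y"] by auto
    obtain k where k: "max (dist undefined x) (dist undefined y) \<le> real k"
      using real_arch_simple by blast
    have "1 / real (Suc (max n k)) \<le> 1 / real (Suc n)" by (simp add: frac_le)
    then have "(x, y) \<in> C (max n k)" using y n k by (auto simp: C_def)
    then show "x \<in> (\<Union>n. fst ` C n)" by (metis UNIV_I UN_I fst_conv image_eqI)
  qed (fastforce simp: C_def divide_le_0_iff)
  moreover have "closed {(x::'a, y). dist x y \<ge> 1 / real (Suc n)}" for n
    unfolding split_def by (intro closed_Collect_le continuous_intros)
  then have "compact (C n)" for n unfolding C_def
    by (intro compact_Int_closed closed_Int_compact E compact_Times proper)
  then have "closed (fst ` C n)" for n
    by (intro compact_imp_closed compact_continuous_image continuous_intros)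
  ultimately show ?thesis by auto
qed

lemma sets_initial_points:
  fixes le :: "'a::metric_space \<Rightarrow> 'a \<Rightarrow> bool"
  assumes proper: "\<And>(x::'a) r. compact (cball x r)" and J: "closed {(x, y). le x y}" and H: "closed H"
  shows "initial_points le H \<in> sets borel"
proof -
  have "closed (prod.swap -` {(x, y). le x y})"
    by (intro closed_vimage J continuous_intros)
  then have "closed (prod.swap -` {(x, y). le x y} \<inter> H \<times> H)"
    by (intro closed_Int closed_Times H)
  from sets_Collect_related_distinct[OF proper this]
  have "H - {x. \<exists>y. (x, y) \<in> prod.swap -` {(x, y). le x y} \<inter> H \<times> H \<and> y \<noteq> x} \<in> sets borel"
    using H by (intro sets.Diff) auto
  also have "H - {x. \<exists>y. (x, y) \<in> prod.swap -` {(x, y). le x y} \<inter> H \<times> H \<and> y \<noteq> x} = initial_points le H"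
    by (auto simp: initial_points_def)
  finally show ?thesis .
qed

lemma sets_final_points:
  fixes le :: "'a::metric_space \<Rightarrow> 'a \<Rightarrow> bool"
  assumes proper: "\<And>(x::'a) r. compact (cball x r)" and J: "closed {(x, y). le x y}" and H: "closed H"
  shows "final_points le H \<in> sets borel"
proof -
  have "closed (prod.swap -` {(x, y). le x y})"
    by (intro closed_vimage J continuous_intros)
  then have "closed {(x, y). le y x}" by (simp add: vimage_def split_def)
  from sets_initial_points[OF proper this H] show ?thesis
    by (simp add: initial_points_def final_points_def)
qed

section \<open>Radon measures on a closed set\<close>

lemma radon_measure_on_space: "radon_measure_on H m \<Longrightarrow> space m = H"
  unfolding radon_measure_on_def by (metis Int_UNIV_right Int_commute sets_eq_imp_space_eq space_borel space_restrict_space)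

lemma radon_measure_on_sets_iff:
  "radon_measure_on H m \<Longrightarrow> closed H \<Longrightarrow> A \<in> sets m \<longleftrightarrow> A \<in> sets borel \<and> A \<subseteq> H"
  unfolding radon_measure_on_def by (simp add: sets_restrict_space_iff conj_commute)

lemma radon_measure_on_compact_finite:
  fixes H :: "'a::t2_space set"
  assumes m: "radon_measure_on H m" and H: "closed H" and K: "compact K" "K \<subseteq> H"
  shows "emeasure m K < \<infinity>"
proof -
  have "\<forall>x\<in>K. \<exists>W. open W \<and> x \<in> W \<and> emeasure m (H \<inter> W) < \<infinity>"
    using m K(2) unfolding radon_measure_on_def openin_open by (metis IntD2 subsetD)
  from bchoice[OF this] obtain W
    where W: "\<forall>x\<in>K. open (W x) \<and> x \<in> W x \<and> emeasure m (H \<inter> W x) < \<infinity>" ..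
  have "K \<subseteq> (\<Union>x\<in>K. W x)" using W by blast
  then obtain D where D: "D \<subseteq> K" "finite D" "K \<subseteq> (\<Union>x\<in>D. W x)"
    by (rule compactE_image[OF K(1), of K W, rotated]) (use W in auto)
  have HW: "H \<inter> W x \<in> sets m" if "x \<in> D" for x
    unfolding radon_measure_on_sets_iff[OF m H]
    using W D(1) that H by (intro conjI sets.Int borel_closed borel_open) auto
  have "emeasure m K \<le> emeasure m (\<Union>x\<in>D. H \<inter> W x)"
    using D K HW by (intro emeasure_mono sets.finite_UN) auto
  also have "\<dots> \<le> (\<Sum>x\<in>D. emeasure m (H \<inter> W x))"
    using D HW by (intro emeasure_subadditive_finite) auto
  also have "\<dots> < \<infinity>" using D W by (auto simp: ennreal_sum_less_top)
  finally show ?thesis .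
qed

lemma radon_measure_on_sigma_finite:
  fixes H :: "'a::metric_space set"
  assumes proper: "\<And>(x::'a) r. compact (cball x r)"
    and m: "radon_measure_on H m" and H: "closed H"
  shows "sigma_finite_measure m"
proof
  let ?C = "range (\<lambda>n. H \<inter> cball undefined (real n))"
  have c: "compact (H \<inter> cball undefined (real n))" for n
    using H proper by (intro closed_Int_compact)
  have "(\<Union>?C) = H"
    using real_arch_simple by auto
  moreover have "?C \<subseteq> sets m"
    using radon_measure_on_sets_iff[OF m H] c by (auto simp: compact_imp_closed)
  moreover have "\<forall>a\<in>?C. emeasure m a \<noteq> \<infinity>"
    using radon_measure_on_compact_finite[OF m H c] by (auto simp: less_top)
  ultimately show "\<exists>A. countable A \<and> A \<subseteq> sets m \<and> \<Union>A = space m \<and> (\<forall>a\<in>A. emeasure m a \<noteq> \<infinity>)"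
    using radon_measure_on_space[OF m] by (intro exI[of _ ?C]) auto
qed

text \<open>Continuity from above. With \<open>K\<close> removed, the neighbourhoods decrease to the
  empty set because \<open>K\<close> is closed; with \<open>K\<close> kept, their measures would
  only tend to that of \<open>K\<close>. A single closed ball of radius \<open>r + 1\<close> bounds
  them all and makes the measures finite.\<close>

lemma radon_measure_on_punctured_neighbourhood:
  fixes H :: "'a::metric_space set"
  assumes proper: "\<And>(x::'a) r. compact (cball x r)"
    and m: "radon_measure_on H m" and H: "closed H" and K: "compact K" "K \<noteq> {}" and d: "\<delta> > 0"
  obtains \<epsilon> where "\<epsilon> > 0" "{x \<in> H. infdist x K < \<epsilon>} - K \<in> sets m"
    "emeasure m ({x \<in> H. infdist x K < \<epsilon>} - K) \<le> ennreal \<delta>"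
proof -
  define B where "B n = {x \<in> H. infdist x K < 1 / real (Suc n)} - K" for n
  have op: "open {x. infdist x K < r}" for r
    by (intro open_Collect_less continuous_intros)
  have "H \<inter> {x. infdist x K < 1 / real (Suc n)} - K \<in> sets borel" for n
    by (intro sets.Diff sets.Int borel_closed H borel_open op compact_imp_closed K(1))
  moreover have "B n = H \<inter> {x. infdist x K < 1 / real (Suc n)} - K" for n
    by (auto simp: B_def)
  ultimately have B: "B n \<in> sets m" for n
    unfolding radon_measure_on_sets_iff[OF m H] by (simp add: le_infI1 subset_iff)
  obtain c r where r: "K \<subseteq> cball c r"
    using compact_imp_bounded[OF K(1)] unfolding bounded_subset_cball by blast
  have "B n \<subseteq> H \<inter> cball c (r + 1)" for n
  proof
    fix x assume x: "x \<in> B n"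
    have "infdist x K < 1 / real (Suc n)" using x by (simp add: B_def)
    also have "\<dots> \<le> 1" by simp
    finally have "(INF k\<in>K. dist x k) < 1" using K(2) by (simp add: infdist_notempty)
    moreover have "bdd_below (dist x ` K)" by (rule bdd_belowI2[of _ 0]) simp
    ultimately obtain k where k: "k \<in> K" "dist x k < 1"
      using K(2) by (auto simp: cINF_less_iff)
    have "dist c k \<le> r" using k r by auto
    then have "dist c x \<le> r + 1" using k(2) dist_triangle2[of c x k] by linarith
    then show "x \<in> H \<inter> cball c (r + 1)" using x by (auto simp: B_def)
  qed
  moreover have comp: "compact (H \<inter> cball c (r + 1))"
    using H proper by (intro closed_Int_compact)
  moreover from comp have "H \<inter> cball c (r + 1) \<in> sets m"
    using radon_measure_on_sets_iff[OF m H] by (auto simp: compact_imp_closed)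
  ultimately have fin: "emeasure m (B n) \<noteq> \<infinity>" for n
    using radon_measure_on_compact_finite[OF m H comp] emeasure_mono[of "B n" "H \<inter> cball c (r + 1)" m]
    by (metis inf.cobounded1 infinity_ennreal_def le_less_trans less_irrefl)
  have "decseq B"
  proof (rule decseq_SucI)
    fix n
    have "1 / real (Suc (Suc n)) \<le> 1 / real (Suc n)" by (simp add: frac_le)
    then show "B (Suc n) \<subseteq> B n" by (auto simp: B_def)
  qed
  then have lim: "(\<lambda>n. emeasure m (B n)) \<longlonglongrightarrow> emeasure m (\<Inter>n. B n)"
    using B fin by (intro Lim_emeasure_decseq) auto
  have "(\<Inter>n. B n) = {}"
  proof (rule ccontr)
    assume "(\<Inter>n. B n) \<noteq> {}"
    then obtain x where x: "\<And>n. x \<in> B n" by blast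
    have "x \<notin> K" using x[of 0] by (simp add: B_def)
    then have "infdist x K > 0"
      using K by (metis compact_imp_closed in_closed_iff_infdist_zero infdist_nonneg order_le_less)
    then obtain n where "1 / real (Suc n) < infdist x K" using nat_approx_posE by metis
    then show False using x[of n] by (simp add: B_def)
  qed
  then have "eventually (\<lambda>n. emeasure m (B n) < ennreal \<delta>) sequentially"
    using lim d by (intro order_tendstoD(2)[OF lim]) simp
  then obtain n where "emeasure m (B n) < ennreal \<delta>"
    by (auto simp: eventually_sequentially)
  then show ?thesis using B[of n] by (intro that[of "1 / real (Suc n)"]) (auto simp: B_def)
qed

section \<open>Transport and connecting curves under the null energy condition\<close>

text \<open>Using two maps out of one probability space, in place of the identity and one map, lets
  the same coupling serve motion to the future, motion to the past, and pairs of Dirac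
  masses.\<close>

lemma graph_coupling:
  fixes le :: "'a::polish_space \<Rightarrow> 'a \<Rightarrow> bool"
  assumes \<mu>: "prob_space \<mu>" and J: "closed {(x, y). le x y}" and H: "closed H"
    and f: "f \<in> \<mu> \<rightarrow>\<^sub>M restrict_space borel H" and g: "g \<in> \<mu> \<rightarrow>\<^sub>M restrict_space borel H"
    and le: "AE x in \<mu>. le (f x) (g x)"
  shows "distr \<mu> (restrict_space borel (H \<times> H)) (\<lambda>x. (f x, g x)) \<in>
    causal_couplings le H (distr \<mu> (restrict_space borel H) f) (distr \<mu> (restrict_space borel H) g)"
proof -
  interpret prob_space \<mu> by fact
  let ?B = "restrict_space borel (H \<times> H) :: ('a \<times> 'a) measure"
  have f': "f \<in> borel_measurable \<mu>" "f \<in> space \<mu> \<rightarrow> H" and g': "g \<in> borel_measurable \<mu>" "g \<in> space \<mu> \<rightarrow> H"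
    using f g by (auto simp: measurable_restrict_space2_iff)
  have fg: "(\<lambda>x. (f x, g x)) \<in> \<mu> \<rightarrow>\<^sub>M ?B"
    using f' g' by (intro measurable_restrict_space2 borel_measurable_Pair) auto
  have proj: "fst \<in> ?B \<rightarrow>\<^sub>M restrict_space borel H" "snd \<in> ?B \<rightarrow>\<^sub>M restrict_space borel H"
    by (intro measurable_restrict_space2[OF _ measurable_restrict_space1]
        borel_measurable_continuous_onI continuous_intros; auto simp: space_restrict_space)+
  have JB: "{(x, y) \<in> H \<times> H. le x y} \<in> sets ?B"
  proof -
    have "{(x, y) \<in> H \<times> H. le x y} = {(x, y). le x y} \<inter> H \<times> H" by auto
    moreover have "closed ({(x, y). le x y} \<inter> H \<times> H)" by (intro closed_Int closed_Times J H)
    ultimately show ?thesis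
      using closed_Times[OF H H] by (simp add: sets_restrict_space_iff)
  qed
  have "prob ((\<lambda>x. (f x, g x)) -` {(x, y) \<in> H \<times> H. le x y} \<inter> space \<mu>) = 1"
  proof (intro AE_in_set_eq_1[THEN iffD1] measurable_sets[OF fg JB])
    show "AE x in \<mu>. x \<in> (\<lambda>x. (f x, g x)) -` {(x, y) \<in> H \<times> H. le x y} \<inter> space \<mu>"
      using le AE_space by eventually_elim (use f'(2) g'(2) in auto)
  qed
  then show ?thesis
    using prob_space_distr[OF fg] fg proj JB
    by (simp add: causal_couplings_def borel_prob_on_def distr_distr comp_def measure_distr)
qed

lemma NCe_transport:
  fixes le :: "'a::polish_space \<Rightarrow> 'a \<Rightarrow> bool"
  assumes NC: "NCe le H G m N" and J: "closed {(x, y). le x y}" and H: "closed H"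
    and \<mu>: "prob_space \<mu>"
    and f: "f \<in> \<mu> \<rightarrow>\<^sub>M restrict_space borel H" and g: "g \<in> \<mu> \<rightarrow>\<^sub>M restrict_space borel H"
    and le: "AE x in \<mu>. le (f x) (g x)"
  obtains \<nu> where "\<nu> \<in> OptGeo le H G (distr \<mu> (restrict_space borel H) f) (distr \<mu> (restrict_space borel H) g)"
    "\<And>t. t \<in> {0..1} \<Longrightarrow> U_ent (N - 1) (eval_push H t \<nu>) m \<ge>
      ennreal (1 - t) * U_ent (N - 1) (distr \<mu> (restrict_space borel H) f) m +
      ennreal t * U_ent (N - 1) (distr \<mu> (restrict_space borel H) g) m"
proof -
  have "borel_prob_on H (distr \<mu> (restrict_space borel H) f)"
    "borel_prob_on H (distr \<mu> (restrict_space borel H) g)"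
    using prob_space.prob_space_distr[OF \<mu> f] prob_space.prob_space_distr[OF \<mu> g]
    by (auto simp: borel_prob_on_def)
  then show ?thesis
    using NC graph_coupling[OF \<mu> J H f g le] that unfolding NCe_def by blast
qed

lemma AE_eval_push_iff:
  assumes "sets \<nu> = sets (curve_borel H)" "t \<in> {0..1}" "A \<in> sets (restrict_space borel H)"
  shows "(AE x in eval_push H t \<nu>. x \<in> A) \<longleftrightarrow> (AE \<gamma> in \<nu>. \<gamma> t \<in> A)"
proof -
  have "(\<lambda>\<gamma>. \<gamma> t) \<in> \<nu> \<rightarrow>\<^sub>M restrict_space borel H"
    using measurable_eval[OF assms(2)] measurable_cong_sets[OF assms(1) refl] by blast
  moreover have "{x \<in> space (restrict_space borel H). x \<in> A} = A"
    using sets.sets_into_space[OF assms(3)] by auto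
  ultimately show ?thesis
    unfolding eval_push_def using assms(3) by (subst AE_distr_iff) auto
qed

lemma AE_Caus:
  assumes "prob_space \<nu>" "measure \<nu> (Caus le H G) = 1"
  shows "AE \<gamma> in \<nu>. \<gamma> \<in> Caus le H G"
proof -
  \<comment> \<open>A set outside the sigma-algebra has \<open>measure\<close> 0, so the value 1
    already implies measurability.\<close>
  have "Caus le H G \<in> sets \<nu>"
    using assms(2) measure_notin_sets by fastforce
  then show ?thesis
    using prob_space.AE_in_set_eq_1[OF assms(1)] assms(2) by blast
qed

text \<open>For Dirac masses at \<open>x\<close> and \<open>y\<close>, almost every curve under
  \<open>\<nu>\<close> is G-causal with these ends, and a probability measure has at least one such
  curve.\<close>

lemma NCe_Caus_connected:
  fixes le :: "'a::polish_space \<Rightarrow> 'a \<Rightarrow> bool"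
  assumes NC: "NCe le H G m N" and J: "closed {(x, y). le x y}" and H: "closed H"
    and xy: "x \<in> H" "y \<in> H" "le x y"
  obtains \<gamma> where "\<gamma> \<in> Caus le H G" "\<gamma> 0 = x" "\<gamma> 1 = y"
proof -
  let ?B = "restrict_space borel H"
  let ?\<mu> = "return (borel :: 'a measure) x"
  have \<mu>: "prob_space ?\<mu>" by (rule prob_space_return) simp
  have f: "(\<lambda>_. z) \<in> ?\<mu> \<rightarrow>\<^sub>M ?B" if "z \<in> H" for z
    using that by (intro measurable_const) (simp add: space_restrict_space)
  obtain \<nu> where \<nu>: "\<nu> \<in> OptGeo le H G (distr ?\<mu> ?B (\<lambda>_. x)) (distr ?\<mu> ?B (\<lambda>_. y))"
    by (rule NCe_transport[OF NC J H \<mu> f[OF xy(1)] f[OF xy(2)]]) (use xy in auto)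
  have sing: "{z} \<in> sets ?B" if "z \<in> H" for z
    using that H by (simp add: sets_restrict_space_iff)
  have dist_AE: "AE w in distr ?\<mu> ?B (\<lambda>_. z). w \<in> {z}" if "z \<in> H" for z
    using f[OF that] sing[OF that]
    by (subst AE_distr_iff) (auto simp: space_restrict_space that cong: conj_cong)
  have \<nu>': "prob_space \<nu>" "sets \<nu> = sets (curve_borel H)" "measure \<nu> (Caus le H G) = 1"
    "eval_push H 0 \<nu> = distr ?\<mu> ?B (\<lambda>_. x)" "eval_push H 1 \<nu> = distr ?\<mu> ?B (\<lambda>_. y)"
    using \<nu> by (auto simp: OptGeo_def)
  have "AE \<gamma> in \<nu>. \<gamma> 0 \<in> {x}"
    using dist_AE[OF xy(1)] unfolding \<nu>'(4)[symmetric]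
    by (subst (asm) AE_eval_push_iff[OF \<nu>'(2) _ sing[OF xy(1)]]) auto
  moreover have "AE \<gamma> in \<nu>. \<gamma> 1 \<in> {y}"
    using dist_AE[OF xy(2)] unfolding \<nu>'(5)[symmetric]
    by (subst (asm) AE_eval_push_iff[OF \<nu>'(2) _ sing[OF xy(2)]]) auto
  ultimately have "AE \<gamma> in \<nu>. \<gamma> \<in> Caus le H G \<and> \<gamma> 0 = x \<and> \<gamma> 1 = y"
    using AE_Caus[OF \<nu>'(1,3)] by eventually_elim simp
  then obtain \<gamma> where "\<gamma> \<in> Caus le H G \<and> \<gamma> 0 = x \<and> \<gamma> 1 = y"
    using eventually_happens'[OF prob_space.ae_filter_bot[OF \<nu>'(1)]] by blast
  then show ?thesis using that by blast
qed

lemma Caus_nonconstantD: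
  assumes "\<gamma> \<in> Caus le H G" "\<gamma> 0 \<noteq> \<gamma> 1"
  shows "causal_curve le {0..1} \<gamma>" "\<gamma> ` {0<..<1} \<subseteq> causal_interior le H"
  using assms unfolding Caus_def by force+

lemma CausD:
  assumes "\<gamma> \<in> Caus le H G"
  shows "continuous_on {0..1} \<gamma>" "\<gamma> ` {0..1} \<subseteq> H"
  using assms by (auto simp: Caus_def mspace_curve_metric)

lemma continuous_curve_near_endpoint:
  fixes \<gamma> :: "real \<Rightarrow> 'a::topological_space"
  assumes c: "continuous_on {0..1} \<gamma>" "\<gamma> ` {0..1} \<subseteq> H"
    and e: "e \<in> {0, 1}" and V: "openin (top_of_set H) V" "\<gamma> e \<in> V"
  obtains t where "t \<in> {0<..<1}" "\<gamma> t \<in> V"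
proof -
  have "openin (top_of_set {0..1}) ({0..1} \<inter> \<gamma> -` V)"
    using continuous_openin_preimage[OF c(1) _ V(1)] c(2) by (simp add: image_subset_iff_funcset)
  then obtain W where W: "open W" "{0..1} \<inter> \<gamma> -` V = {0..1} \<inter> W"
    unfolding openin_open by blast
  have "e \<in> {0..1} \<inter> \<gamma> -` V" using e V by auto
  then have "e \<in> W" using W(2) by blast
  then obtain r where r: "r > 0" "ball e r \<subseteq> W" using W(1) by (meson openE)
  define s where "s = min (r / 2) (1 / 2)"
  define t where "t = (if e = 0 then s else 1 - s)"
  have "t \<in> {0<..<1}" "dist e t < r"
    using e r(1) by (auto simp: t_def s_def dist_real_def)
  then have "t \<in> {0<..<1}" "t \<in> {0..1} \<inter> W" using r(2) by auto
  then show ?thesis using that W(2) by blast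
qed

section \<open>Localising the mass and the contradiction at one end\<close>

lemma radon_measure_on_compact_pos:
  assumes m: "radon_measure_on H m" and A: "A \<in> sets m" "A \<notin> null_sets m"
  obtains K where "compact K" "K \<subseteq> A" "emeasure m K > 0"
proof -
  have "0 < emeasure m A" using A by (simp add: null_sets_def zero_less_iff_neq_zero)
  also have "\<dots> = (SUP K\<in>{K. compact K \<and> K \<subseteq> A}. emeasure m K)"
    using m A(1) by (simp add: radon_measure_on_def)
  finally show ?thesis using that by (auto simp: less_SUP_iff)
qed

text \<open>Prepares the selection so that tightness applies: finitely many tight neighbourhoods
  cover a compact part of \<open>A\<close>, so one of them carries positive mass, and
  \<open>step\<close> supplies partners inside that same neighbourhood. Both ends of the later
  curves then lie in a single \<open>U\<close>.\<close>

lemma compact_graph_over_nonnull_set: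
  fixes R :: "('a::polish_space \<times> 'a) set"
  assumes R: "closed R" and H: "closed H" and m: "radon_measure_on H m" and tight: "tight_gauge le H G"
    and A: "A \<in> sets m" "A \<notin> null_sets m"
    and step: "\<And>x V. x \<in> A \<Longrightarrow> openin (top_of_set H) V \<Longrightarrow> x \<in> V \<Longrightarrow> \<exists>y\<in>V. (x, y) \<in> R \<and> y \<noteq> x"
  obtains C U where "compact C" "C \<subseteq> R" "C \<subseteq> (A \<inter> U) \<times> U" "\<forall>(x, y)\<in>C. y \<noteq> x"
    "emeasure m (fst ` C) > 0" "compact U" "U \<subseteq> H"
    "compactin (mtopology_of (curve_metric H)) {\<gamma> \<in> Caus le H G. \<gamma> 0 \<in> U \<and> \<gamma> 1 \<in> U}"
proof -
  obtain K where K: "compact K" "K \<subseteq> A" "emeasure m K > 0"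
    using radon_measure_on_compact_pos[OF m A] .
  have AH: "A \<subseteq> H" using A(1) radon_measure_on_sets_iff[OF m H] by blast
  define good where "good U W \<longleftrightarrow> compact U \<and> U \<subseteq> H \<and> open W \<and> H \<inter> W \<subseteq> U \<and>
     compactin (mtopology_of (curve_metric H)) {\<gamma> \<in> Caus le H G. \<gamma> 0 \<in> U \<and> \<gamma> 1 \<in> U}" for U W
  have "\<exists>W. x \<in> W \<and> (\<exists>U. good U W)" if "x \<in> K" for x
  proof -
    have "x \<in> H" using that K(2) AH by blast
    from bspec[OF tight[unfolded tight_gauge_def] this]
    obtain U V where UV: "compact U" "U \<subseteq> H" "openin (top_of_set H) V" "x \<in> V" "V \<subseteq> U"
       "compactin (mtopology_of (curve_metric H)) {\<gamma> \<in> Caus le H G. \<gamma> 0 \<in> U \<and> \<gamma> 1 \<in> U}"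
      by (elim exE conjE)
    then obtain W where "open W" "V = H \<inter> W" unfolding openin_open by blast
    then have "x \<in> W" "good U W" using UV unfolding good_def by auto
    then show ?thesis by blast
  qed
  then have "\<forall>x\<in>K. \<exists>W. x \<in> W \<and> (\<exists>U. good U W)" by simp
  from bchoice[OF this] obtain W
    where W: "\<And>x. x \<in> K \<Longrightarrow> x \<in> W x" "\<And>x. x \<in> K \<Longrightarrow> \<exists>U. good U (W x)"
    by auto
  have Wo: "open (W x)" if "x \<in> K" for x using W(2)[OF that] by (auto simp: good_def)
  obtain D where D: "D \<subseteq> K" "finite D" "K \<subseteq> (\<Union>x\<in>D. W x)"
    by (rule compactE_image[OF K(1), of K W]) (use W Wo in auto)
  have KW: "K \<inter> W x \<in> sets m" if "x \<in> D" for x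
    unfolding radon_measure_on_sets_iff[OF m H]
    using that D(1) K(2) AH
    by (intro conjI sets.Int borel_open[OF Wo] borel_closed[OF compact_imp_closed[OF K(1)]]) auto
  have "\<exists>x\<in>D. emeasure m (K \<inter> W x) \<noteq> 0"
  proof (rule ccontr)
    assume "\<not> ?thesis"
    then have "(\<Union>x\<in>D. K \<inter> W x) \<in> null_sets m"
      using D(2) KW by (intro null_sets.finite_UN) auto
    moreover have "(\<Union>x\<in>D. K \<inter> W x) = K" using D(3) by blast
    ultimately show False using K(3) by auto
  qed
  then obtain x0 where x0: "x0 \<in> D" "emeasure m (K \<inter> W x0) \<noteq> 0" by blast
  obtain U where U: "good U (W x0)" using W(2) x0(1) D(1) by blast
  \<comment> \<open>Being distinct is not a closed condition; a lower bound on the distance is. The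
    projections of these compact pieces cover \<open>K \<inter> W x0\<close>, so one of them is
    non-null.\<close>
  define C where "C n = (K \<inter> U) \<times> U \<inter> R \<inter> {(x, y). dist x y \<ge> 1 / real (Suc n)}" for n
  have "closed {(x::'a, y). dist x y \<ge> 1 / real (Suc n)}" for n
    unfolding split_def by (intro closed_Collect_le continuous_intros)
  then have C: "compact (C n)" for n
    unfolding C_def using K(1) U R
    by (intro compact_Int_closed compact_Times compact_Int) (auto simp: good_def)
  then have cC: "compact (fst ` C n)" for n
    by (intro compact_continuous_image continuous_intros)
  have CK: "fst ` C n \<subseteq> K" for n by (auto simp: C_def)
  have sC: "fst ` C n \<in> sets m" for n
    unfolding radon_measure_on_sets_iff[OF m H] using order_trans[OF CK order_trans[OF K(2) AH]]
    by (intro conjI borel_closed compact_imp_closed cC)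
  have sub: "K \<inter> W x0 \<subseteq> (\<Union>n. fst ` C n)"
  proof
    fix x assume x: "x \<in> K \<inter> W x0"
    have "openin (top_of_set H) (H \<inter> W x0)"
      using U by (auto simp: good_def intro: openin_open_Int)
    then obtain y where y: "y \<in> H \<inter> W x0" "(x, y) \<in> R" "y \<noteq> x"
      using step[of x "H \<inter> W x0"] x K(2) AH by blast
    obtain n where n: "1 / real (Suc n) < dist x y"
      using y(3) nat_approx_posE[of "dist x y"] by auto
    have "(x, y) \<in> C n"
      using x y n U K(2) AH by (auto simp: C_def good_def)
    then show "x \<in> (\<Union>n. fst ` C n)" by (metis UNIV_I UN_I fst_conv image_eqI)
  qed
  have "\<exists>n. emeasure m (fst ` C n) \<noteq> 0"
  proof (rule ccontr)
    assume "\<not> ?thesis"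
    then have "(\<Union>n. fst ` C n) \<in> null_sets m"
      using sC by (intro null_sets_UN) auto
    then have "K \<inter> W x0 \<in> null_sets m"
      using sub KW[OF x0(1)] by (meson null_sets_subset)
    then show False using x0(2) by auto
  qed
  then obtain n where n: "emeasure m (fst ` C n) \<noteq> 0" by blast
  show ?thesis
  proof (rule that[of "C n" U])
    show "\<forall>(x, y)\<in>C n. y \<noteq> x" by (auto simp: C_def divide_le_0_iff)
  qed (use C n U K(2) in \<open>auto simp: C_def good_def zero_less_iff_neq_zero\<close>)
qed

text \<open>The parameter \<open>e\<close> is the end of the curves at which the mass sits on \<open>A\<close>; both ends are
  covered at once, so that no time reversal of curves is needed.\<close>

lemma null_set_of_transport:
  fixes R :: "('a::polish_space \<times> 'a) set" and e n :: real
  assumes proper: "\<And>(x::'a) r. compact (cball x r)"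
    and R: "closed R" and H: "closed H" and m: "radon_measure_on H m" and tight: "tight_gauge le H G"
    and e: "e \<in> {0, 1}" and n: "n > 0"
    and A: "A \<in> sets m" "A \<inter> causal_interior le H = {}"
    and step: "\<And>x V. x \<in> A \<Longrightarrow> openin (top_of_set H) V \<Longrightarrow> x \<in> V \<Longrightarrow> \<exists>y\<in>V. (x, y) \<in> R \<and> y \<noteq> x"
    and leave: "\<And>x y. x \<in> A \<Longrightarrow> y \<in> H \<Longrightarrow> (x, y) \<in> R \<Longrightarrow> y \<noteq> x \<Longrightarrow> y \<notin> A"
    and transport: "\<And>\<mu> T. prob_space \<mu> \<Longrightarrow> sets \<mu> = sets (restrict_space borel H) \<Longrightarrow>
      T \<in> \<mu> \<rightarrow>\<^sub>M restrict_space borel H \<Longrightarrow> AE x in \<mu>. (x, T x) \<in> R \<Longrightarrow>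
      \<exists>\<nu>. prob_space \<nu> \<and> sets \<nu> = sets (curve_borel H) \<and> eval_push H e \<nu> = \<mu> \<and>
        eval_push H (1 - e) \<nu> = distr \<mu> (restrict_space borel H) T \<and> measure \<nu> (Caus le H G) = 1 \<and>
        (\<forall>t\<in>{0..1}. U_ent n (eval_push H t \<nu>) m \<ge> ennreal (1 - \<bar>t - e\<bar>) * U_ent n \<mu> m)"
  shows "A \<in> null_sets m"
proof (rule ccontr)
  assume nonnull: "A \<notin> null_sets m"
  let ?B = "restrict_space borel H"
  obtain C U where C: "compact C" "C \<subseteq> R" "C \<subseteq> (A \<inter> U) \<times> U" "\<forall>(x, y)\<in>C. y \<noteq> x"
    and pos: "emeasure m (fst ` C) > 0" and U: "compact U" "U \<subseteq> H"
    and comp: "compactin (mtopology_of (curve_metric H)) {\<gamma> \<in> Caus le H G. \<gamma> 0 \<in> U \<and> \<gamma> 1 \<in> U}"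
    by (rule compact_graph_over_nonnull_set[OF R H m tight A(1) nonnull step])
  define K where "K = fst ` C"
  have K: "compact K" "K \<subseteq> A" "K \<subseteq> U" "K \<subseteq> H"
    using C U(2) by (auto simp: K_def intro!: compact_continuous_image continuous_intros)
  have sm: "sets m = sets ?B" using m by (simp add: radon_measure_on_def)
  have Km: "K \<in> sets m" "K \<in> sets borel" "U \<in> sets ?B"
    using K U unfolding sm[symmetric] radon_measure_on_sets_iff[OF m H]
    by (auto intro: borel_closed compact_imp_closed)
  have KB: "K \<in> sets ?B" using Km sm by simp
  have Kfin: "emeasure m K \<noteq> 0" "emeasure m K \<noteq> \<infinity>"
    using pos radon_measure_on_compact_finite[OF m H K(1,4)] by (auto simp: K_def)
  obtain T where T: "T \<in> borel_measurable (restrict_space borel K)" "\<And>x. x \<in> K \<Longrightarrow> (x, T x) \<in> C"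
    using compact_Borel_selection[OF C(1)] unfolding K_def by blast
  \<comment> \<open>The measure is concentrated on \<open>K\<close>, so the identity elsewhere only
    serves to obtain a measurable map from \<open>H\<close> to \<open>H\<close>.\<close>
  define T' where "T' x = (if x \<in> K then T x else x)" for x
  \<comment> \<open>Only the two marginals of \<open>\<nu>\<close> will be known, not which start is
    joined to which end. Hence \<open>T x \<noteq> x\<close> would not exclude constant curves,
    whereas an image disjoint from all of \<open>K\<close> does.\<close>
  have TU: "T x \<in> U - K" if "x \<in> K" for x
  proof -
    have "(x, T x) \<in> C" using T(2) that .
    then have "x \<in> A" "T x \<in> U" "(x, T x) \<in> R" "T x \<noteq> x" using C by auto
    then show ?thesis using leave[of x "T x"] U(2) K(2) by blast
  qed
  define \<mu> where "\<mu> = uniform_measure m K"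
  have \<mu>: "prob_space \<mu>" "sets \<mu> = sets ?B"
    unfolding \<mu>_def using Kfin sm by (auto intro: prob_space_uniform_measure)
  have spB: "space ?B = H" by (simp add: space_restrict_space)
  have T'm: "T' \<in> \<mu> \<rightarrow>\<^sub>M ?B"
    unfolding measurable_cong_sets[OF \<mu>(2) refl]
  proof (rule measurable_restrict_space2)
    show "T' \<in> space ?B \<rightarrow> H" using TU U(2) by (force simp: T'_def spB)
    have "T' \<in> borel_measurable borel"
      unfolding T'_def using T(1) Km(2) by (intro measurable_If_restrict_space_iff[THEN iffD2])
        (auto intro: measurable_restrict_space1)
    then show "T' \<in> borel_measurable ?B" by (rule measurable_restrict_space1)
  qed
  have AEK: "AE x in \<mu>. x \<in> K"
    unfolding \<mu>_def using Km Kfin by (intro AE_uniform_measureI) auto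
  then have "AE x in \<mu>. (x, T' x) \<in> R"
    by eventually_elim (use T(2) C(2) in \<open>auto simp: T'_def\<close>)
  from transport[OF \<mu> T'm this] obtain \<nu> where \<nu>: "prob_space \<nu>" "sets \<nu> = sets (curve_borel H)"
      "eval_push H e \<nu> = \<mu>" "eval_push H (1 - e) \<nu> = distr \<mu> ?B T'" "measure \<nu> (Caus le H G) = 1"
    and ent: "\<And>t. t \<in> {0..1} \<Longrightarrow> U_ent n (eval_push H t \<nu>) m \<ge> ennreal (1 - \<bar>t - e\<bar>) * U_ent n \<mu> m"
    by blast
  have e01: "e \<in> {0..1}" "1 - e \<in> {0..1}" using e by auto
  have AE_e: "AE \<gamma> in \<nu>. \<gamma> e \<in> K"
    using AEK unfolding \<nu>(3)[symmetric] by (subst (asm) AE_eval_push_iff[OF \<nu>(2) e01(1) KB])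
  have UKB: "U - K \<in> sets ?B" using Km KB by auto
  have "AE x in distr \<mu> ?B T'. x \<in> U - K"
  proof (subst AE_distr_iff[OF T'm])
    have "{x \<in> space ?B. x \<in> U - K} = U - K"
      using sets.sets_into_space[OF UKB] by blast
    then show "{x \<in> space ?B. x \<in> U - K} \<in> sets ?B" using UKB by simp
    show "AE x in \<mu>. T' x \<in> U - K"
      using AEK by eventually_elim (use TU in \<open>auto simp: T'_def\<close>)
  qed
  then have AE_1: "AE \<gamma> in \<nu>. \<gamma> (1 - e) \<in> U - K"
    unfolding \<nu>(4)[symmetric] by (subst (asm) AE_eval_push_iff[OF \<nu>(2) e01(2) UKB])
  have u: "U_ent n \<mu> m > 0"
    unfolding \<mu>_def using Km Kfin n
    by (intro U_ent_pos Ent_uniform_measure_finite radon_measure_on_sigma_finite[OF proper m H])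
  then have "ennreal (1 / 2) * U_ent n \<mu> m > 0"
    by (simp add: ennreal_zero_less_mult_iff del: ennreal_half)
  then obtain q where q: "0 < q" "q < ennreal (1 / 2) * U_ent n \<mu> m" using dense by blast
  then obtain c where "q = ennreal c" by (cases q) auto
  then have c: "ennreal c > 0" "ennreal c < ennreal (1 / 2) * U_ent n \<mu> m" using q by auto
  then have c0: "c > 0" by (simp add: ennreal_less_zero_iff)
  define \<delta> where "\<delta> = exp (n * ln c)"
  have \<delta>: "\<delta> > 0" "exp (ln \<delta> / n) = c" using n c0 by (auto simp: \<delta>_def)
  have "K \<noteq> {}" using Kfin by auto
  then obtain \<epsilon> where \<epsilon>: "\<epsilon> > 0" "{x \<in> H. infdist x K < \<epsilon>} - K \<in> sets m"
    "emeasure m ({x \<in> H. infdist x K < \<epsilon>} - K) \<le> ennreal \<delta>"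
    using radon_measure_on_punctured_neighbourhood[OF proper m H K(1) _ \<delta>(1)] by blast
  obtain \<tau> where \<tau>: "\<tau> > 0" "\<forall>\<gamma>\<in>{\<gamma> \<in> Caus le H G. \<gamma> 0 \<in> U \<and> \<gamma> 1 \<in> U}.
      \<forall>s\<in>{0..1}. \<forall>t\<in>{0..1}. \<bar>s - t\<bar> < \<tau> \<longrightarrow> dist (\<gamma> s) (\<gamma> t) < \<epsilon>"
    using compact_curves_equicontinuous[OF comp \<epsilon>(1)] .
  \<comment> \<open>The cap 1/2 keeps \<open>t\<close> strictly inside the unit interval and the
    weight at \<open>t\<close> at least 1/2.\<close>
  define s where "s = min (\<tau> / 2) (1 / 2)"
  define t where "t = (if e = 0 then s else 1 - s)"
  have t: "t \<in> {0<..<1}" "\<bar>t - e\<bar> < \<tau>" "\<bar>t - e\<bar> \<le> 1 / 2"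
    using e \<tau>(1) by (auto simp: t_def s_def)
  then have t01: "t \<in> {0..1}" by auto
  have "AE \<gamma> in \<nu>. \<gamma> t \<in> {x \<in> H. infdist x K < \<epsilon>} - K"
    using AE_e AE_1 AE_Caus[OF \<nu>(1,5)]
  proof eventually_elim
    fix \<gamma> assume g: "\<gamma> e \<in> K" "\<gamma> (1 - e) \<in> U - K" "\<gamma> \<in> Caus le H G"
    then have ends: "\<gamma> 0 \<in> U" "\<gamma> 1 \<in> U" "\<gamma> 0 \<noteq> \<gamma> 1" using e K(3) by auto
    have "\<gamma> t \<in> causal_interior le H" using Caus_nonconstantD(2)[OF g(3) ends(3)] t(1) by blast
    then have "\<gamma> t \<notin> K" using A(2) K(2) by blast
    moreover have "dist (\<gamma> t) (\<gamma> e) < \<epsilon>"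
      using \<tau>(2) g ends t t01 e01 by blast
    then have "infdist (\<gamma> t) K < \<epsilon>" using infdist_le[OF g(1), of "\<gamma> t"] by simp
    moreover have "\<gamma> t \<in> H" using CausD(2)[OF g(3)] t01 by blast
    ultimately show "\<gamma> t \<in> {x \<in> H. infdist x K < \<epsilon>} - K" by simp
  qed
  then have AEt: "AE x in eval_push H t \<nu>. x \<in> {x \<in> H. infdist x K < \<epsilon>} - K"
    using \<epsilon>(2) sm by (subst AE_eval_push_iff[OF \<nu>(2) t01]) auto
  have pt: "prob_space (eval_push H t \<nu>)"
    unfolding eval_push_def using measurable_eval[OF t01] measurable_cong_sets[OF \<nu>(2) refl]
    by (intro prob_space.prob_space_distr[OF \<nu>(1)]) blast
  have st: "sets (eval_push H t \<nu>) = sets m" by (simp add: eval_push_def sm)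
  have "emeasure (eval_push H t \<nu>) ({x \<in> H. infdist x K < \<epsilon>} - K) = 1"
    using prob_space.emeasure_eq_1_AE[OF pt _ AEt] \<epsilon>(2) st by simp
  from Ent_ge_neg_ln[OF pt st \<epsilon>(2) this \<epsilon>(3) \<delta>(1)]
  have "U_ent n (eval_push H t \<nu>) m \<le> ennreal (exp (- (- ln \<delta>) / n))"
    by (rule U_ent_le[OF n])
  also have "\<dots> = ennreal c" using \<delta>(2) by simp
  also have "\<dots> < ennreal (1 / 2) * U_ent n \<mu> m" by (rule c(2))
  also have "\<dots> \<le> ennreal (1 - \<bar>t - e\<bar>) * U_ent n \<mu> m"
    using t(3) by (intro mult_right_mono ennreal_leI) auto
  also have "\<dots> \<le> U_ent n (eval_push H t \<nu>) m" by (rule ent[OF t01])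
  finally show False by simp
qed

theorem proposition3p17:
  fixes ll le :: "'a::polish_space \<Rightarrow> 'a \<Rightarrow> bool"
    and H :: "'a set" and G :: "'a \<Rightarrow> real" and m :: "'a measure" and N :: real
  assumes "topological_causal_space ll le"
    and "synthetic_null_hypersurface ll le H G m"
    and "N > 1"
    and "NCe le H G m N"
    and "tight_gauge le H G"
  shows "initial_points le H \<in> null_sets m \<and> final_points le H \<in> null_sets m"
proof -
  have proper: "\<And>(x::'a) r. compact (cball x r)" and J: "closed {(x, y). le x y}"
    using assms(1) by (auto simp: topological_causal_space_def)
  have H: "closed H" and m: "radon_measure_on H m" and stat: "static_points le H \<in> null_sets m"
    using assms(2) by (auto simp: synthetic_null_hypersurface_def)
  note NC = assms(4) and tight = assms(5)
  have N: "N - 1 > 0" using assms(3) by simp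
  have "closed (prod.swap -` {(x, y). le x y})"
    by (intro closed_vimage J continuous_intros)
  then have J': "closed {(x, y). le y x}" by (simp add: vimage_def split_def)
  have sets: "initial_points le H \<in> sets m" "final_points le H \<in> sets m"
    unfolding radon_measure_on_sets_iff[OF m H]
    using sets_initial_points[OF proper J H] sets_final_points[OF proper J H]
    by (auto simp: initial_points_def final_points_def)
  have id: "(\<lambda>x. x) \<in> \<mu> \<rightarrow>\<^sub>M restrict_space borel H" "distr \<mu> (restrict_space borel H) (\<lambda>x. x) = \<mu>"
    if "sets \<mu> = sets (restrict_space borel H)" for \<mu> :: "'a measure"
    using that by (auto simp: measurable_def sets_eq_imp_space_eq[OF that] intro: distr_id2)
  \<comment> \<open>Turns a possibly distant causal partner into one inside any prescribed
    neighbourhood of an end point. Lying in the causal interior separates it from that end point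
    whenever the latter is initial or final.\<close>
  have near: "\<exists>t\<in>{0<..<1}. \<gamma> t \<in> V \<and> \<gamma> t \<in> causal_interior le H \<and> le (\<gamma> 0) (\<gamma> t) \<and> le (\<gamma> t) (\<gamma> 1)"
    if g: "\<gamma> \<in> Caus le H G" "\<gamma> 0 \<noteq> \<gamma> 1" and V: "e \<in> {0, 1}" "openin (top_of_set H) V" "\<gamma> e \<in> V" for \<gamma> e V
  proof -
    obtain t where t: "t \<in> {0<..<1}" "\<gamma> t \<in> V"
      using continuous_curve_near_endpoint[OF CausD[OF g(1)] V] .
    then show ?thesis
      using Caus_nonconstantD[OF g] by (intro bexI[of _ t]) (auto simp: causal_curve_def)
  qed
  have "initial_points le H - final_points le H \<in> null_sets m"
  \<comment> \<open>The condition \<open>leave\<close> holds here because a point of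
    \<open>H\<close> with a distinct initial point below it is itself not initial.\<close>
  proof (rule null_set_of_transport[OF proper J H m tight, where e=0 and n="N - 1"])
    fix x V assume x: "x \<in> initial_points le H - final_points le H"
      and V: "openin (top_of_set H) V" "x \<in> V"
    then obtain y where y: "x \<in> H" "y \<in> H" "le x y" "y \<noteq> x"
      by (auto simp: final_points_def initial_points_def)
    obtain \<gamma> where \<gamma>: "\<gamma> \<in> Caus le H G" "\<gamma> 0 = x" "\<gamma> 1 = y"
      using NCe_Caus_connected[OF NC J H y(1-3)] .
    then obtain t where "\<gamma> t \<in> V" "\<gamma> t \<in> causal_interior le H" "le x (\<gamma> t)"
      using near[of \<gamma> 0 V] y(4) V by auto
    then show "\<exists>y\<in>V. (x, y) \<in> {(x, y). le x y} \<and> y \<noteq> x"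
      using x by (intro bexI[of _ "\<gamma> t"]) (auto simp: causal_interior_def)
  next
    fix \<mu> :: "'a measure" and T
    assume \<mu>: "prob_space \<mu>" "sets \<mu> = sets (restrict_space borel H)"
      and T: "T \<in> \<mu> \<rightarrow>\<^sub>M restrict_space borel H" "AE x in \<mu>. (x, T x) \<in> {(x, y). le x y}"
    obtain \<nu> where \<nu>: "\<nu> \<in> OptGeo le H G \<mu> (distr \<mu> (restrict_space borel H) T)"
      "\<And>t. t \<in> {0..1} \<Longrightarrow> U_ent (N - 1) (eval_push H t \<nu>) m \<ge>
        ennreal (1 - t) * U_ent (N - 1) \<mu> m + ennreal t * U_ent (N - 1) (distr \<mu> (restrict_space borel H) T) m"
      by (rule NCe_transport[OF NC J H \<mu>(1) id(1)[OF \<mu>(2)] T(1)]) (use T(2) id(2)[OF \<mu>(2)] in auto)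
    \<comment> \<open>The summand of the transported measure is nonnegative and is dropped.\<close>
    moreover have "U_ent (N - 1) (eval_push H t \<nu>) m \<ge> ennreal (1 - \<bar>t - 0\<bar>) * U_ent (N - 1) \<mu> m"
      if "t \<in> {0..1}" for t
      using order_trans[OF _ \<nu>(2)[OF that]] that by simp
    ultimately show "\<exists>\<nu>. prob_space \<nu> \<and> sets \<nu> = sets (curve_borel H) \<and> eval_push H 0 \<nu> = \<mu> \<and>
        eval_push H (1 - 0) \<nu> = distr \<mu> (restrict_space borel H) T \<and> measure \<nu> (Caus le H G) = 1 \<and>
        (\<forall>t\<in>{0..1}. U_ent (N - 1) (eval_push H t \<nu>) m \<ge> ennreal (1 - \<bar>t - 0\<bar>) * U_ent (N - 1) \<mu> m)"
      by (intro exI[of _ \<nu>]) (simp add: OptGeo_def)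
  qed (use sets N in \<open>auto simp: causal_interior_def initial_points_def\<close>)
  moreover have "final_points le H - initial_points le H \<in> null_sets m"
  \<comment> \<open>The relation is reversed and the two maps given to \<open>NCe_transport\<close>
    change places, so the known measure sits at time 1 and the curves still run to the
    future.\<close>
  proof (rule null_set_of_transport[OF proper J' H m tight, where e=1 and n="N - 1"])
    fix x V assume x: "x \<in> final_points le H - initial_points le H"
      and V: "openin (top_of_set H) V" "x \<in> V"
    then obtain y where y: "y \<in> H" "x \<in> H" "le y x" "y \<noteq> x"
      by (auto simp: final_points_def initial_points_def)
    obtain \<gamma> where \<gamma>: "\<gamma> \<in> Caus le H G" "\<gamma> 0 = y" "\<gamma> 1 = x"
      using NCe_Caus_connected[OF NC J H y(1-3)] .
    then obtain t where "\<gamma> t \<in> V" "\<gamma> t \<in> causal_interior le H" "le (\<gamma> t) x"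
      using near[of \<gamma> 1 V] y(4) V by auto
    then show "\<exists>y\<in>V. (x, y) \<in> {(x, y). le y x} \<and> y \<noteq> x"
      using x by (intro bexI[of _ "\<gamma> t"]) (auto simp: causal_interior_def)
  next
    fix \<mu> :: "'a measure" and T
    assume \<mu>: "prob_space \<mu>" "sets \<mu> = sets (restrict_space borel H)"
      and T: "T \<in> \<mu> \<rightarrow>\<^sub>M restrict_space borel H" "AE x in \<mu>. (x, T x) \<in> {(x, y). le y x}"
    obtain \<nu> where \<nu>: "\<nu> \<in> OptGeo le H G (distr \<mu> (restrict_space borel H) T) \<mu>"
      "\<And>t. t \<in> {0..1} \<Longrightarrow> U_ent (N - 1) (eval_push H t \<nu>) m \<ge>
        ennreal (1 - t) * U_ent (N - 1) (distr \<mu> (restrict_space borel H) T) m + ennreal t * U_ent (N - 1) \<mu> m"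
      by (rule NCe_transport[OF NC J H \<mu>(1) T(1) id(1)[OF \<mu>(2)]]) (use T(2) id(2)[OF \<mu>(2)] in auto)
    moreover have "U_ent (N - 1) (eval_push H t \<nu>) m \<ge> ennreal (1 - \<bar>t - 1\<bar>) * U_ent (N - 1) \<mu> m"
      if "t \<in> {0..1}" for t
      using order_trans[OF _ \<nu>(2)[OF that]] that by simp
    ultimately show "\<exists>\<nu>. prob_space \<nu> \<and> sets \<nu> = sets (curve_borel H) \<and> eval_push H 1 \<nu> = \<mu> \<and>
        eval_push H (1 - 1) \<nu> = distr \<mu> (restrict_space borel H) T \<and> measure \<nu> (Caus le H G) = 1 \<and>
        (\<forall>t\<in>{0..1}. U_ent (N - 1) (eval_push H t \<nu>) m \<ge> ennreal (1 - \<bar>t - 1\<bar>) * U_ent (N - 1) \<mu> m)"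
      by (intro exI[of _ \<nu>]) (simp add: OptGeo_def)
  qed (use sets N in \<open>auto simp: causal_interior_def final_points_def\<close>)
  moreover have "initial_points le H = (initial_points le H - final_points le H) \<union> static_points le H"
    "final_points le H = (final_points le H - initial_points le H) \<union> static_points le H"
    by (auto simp: static_points_def)
  ultimately show ?thesis using stat by (metis null_sets.Un)
qed

end
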